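(* Let $\vartheta>0$, let $(\lambda_i)_{i\geqslant1}$, $(\lambda_i^\circ)_{i\geqslant1}$, $(r_i)_{i\geqslant1}$ be sequences of positive numbers, put $\bar\lambda_i:=\lambda_i+\lambda_i^\circ$, and let $L$ and $L^\circ$ be non-negative random variables with Laplace transforms $\ell(\gamma)=\mathbb{E}\,e^{-\gamma L}$ and $\ell^\circ(\gamma)=\mathbb{E}\,e^{-\gamma L^\circ}$. Let $\psi_n(\gamma)$ be the transform of the ruin probability in the model with default and non-default losses and $n$ initial obligors (defined in the context). Then $\psi_0(\gamma)=0$ for all $\gamma>0$, and for every $n\in\mathbb{N}=\{1,2,\ldots\}$ and every $\gamma>0$ with $\gamma\neq\frac{\bar\lambda_n+\vartheta}{r_n}$, \begin{align*}\psi_{n}(\gamma)=\ & \frac{\bar\lambda_n}{\bar\lambda_n+\vartheta}\,\frac{1}{\gamma}+\frac{\lambda_n}{\bar\lambda_n+\vartheta-\gamma r_n}\left(B\left(\frac{\bar\lambda_n+\vartheta}{r_n},\psi_{n-1}\left(\frac{\bar\lambda_n+\vartheta}{r_n}\right)\right)-B\left(\gamma,\psi_{n-1}(\gamma)\right)\right)\\ &+\frac{\lambda_n^\circ}{\bar\lambda_n+\vartheta-\gamma r_n}\left(B^\circ\left(\frac{\bar\lambda_n+\vartheta}{r_n},\psi_{n}\left(\frac{\bar\lambda_n+\vartheta}{r_n}\right)\right)-B^\circ\left(\gamma,\psi_{n}(\gamma)\right)\right),\end{align*} where \[B(x,y):=\ell(x)\left(\frac1x-y\right),\qquad B^\ci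rc(x,y):=\ell^\circ(x)\left(\frac1x-y\right).\]
   Context: Model. At time $0$ there are $n$ obligors and the initial reserve is $u>0$. While $i\geqslant1$ obligors have not yet defaulted: the reserve increases linearly at rate $r_i$; defaults occur at Poisson rate $\lambda_i$, each default decreasing the number of obligors by one and the reserve by a loss distributed as $L$; and, independently, non-default losses occur at Poisson rate $\lambda_i^\circ$, each decreasing the reserve by a loss distributed as $L^\circ$ and leaving the number of obligors unchanged. All event times and losses are independent. When no obligors are left, the reserve no longer changes. The net cumulative loss at time $s$ is $u$ minus the reserve at time $s$ (so it starts at $0$). Let $Z_n\geqslant0$ be the supremum of the net cumulative loss process over $[0,E]$, where $E$ is an exponentially distributed time with mean $\vartheta^{-1}$, independent of everything else. Then $p_n(u):=\mathbb{P}(Z_n\geqslant u)$ is the probability of ruin before time $E$, and for $\gamma>0$, \[\psi_n(\gamma):=\int_0^\infty e^{-\gamma u}p_n(u)\,\mathrm{d}u .\] *)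

theory Defs
  imports "HOL-Probability.Probability"
begin

text \<open>
  The primitive random variables. Poisson events are described through independent exponential
  waiting times: while \<open>i\<close> obligors are present, \<open>DefaultWait i\<close> is the time until the next default
  and \<open>OtherWait i 0, OtherWait i 1, \<dots>\<close> are the inter-arrival times of a Poisson process of
  non-default losses that is started on entry to this phase (by memorylessness the law is the same
  as for one that runs throughout). \<open>DefaultLoss i\<close> is the loss at the default that ends the phase,
  \<open>OtherLoss i k\<close> the loss at the \<open>k\<close>-th non-default event of the phase.
\<close>

datatype source =
    Horizon
  | DefaultWait nat
  | DefaultLoss nat
  | OtherWait nat nat
  | OtherLoss nat nat

definition sources :: "source set" where
  "sources = {Horizon} \<union> (\<Union>i\<in>{1..}. {DefaultWait i, DefaultLoss i}
                \<union> range (OtherWait i) \<union> range (OtherLoss i))"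

text \<open>
  One family \<open>X\<close> serves every initial number of obligors: the model with \<open>n\<close> obligors uses the
  indices \<open>i \<le> n\<close> only. No joint law of \<open>L\<close>, \<open>Lo\<close> and \<open>X\<close> is prescribed; \<open>L\<close> and \<open>Lo\<close> just carry
  the two loss distributions.
\<close>

definition obligor_model ::
  "'a measure \<Rightarrow> (nat \<Rightarrow> real) \<Rightarrow> (nat \<Rightarrow> real) \<Rightarrow> real \<Rightarrow> ('a \<Rightarrow> real) \<Rightarrow> ('a \<Rightarrow> real)
    \<Rightarrow> (source \<Rightarrow> 'a \<Rightarrow> real) \<Rightarrow> bool" where
  "obligor_model M lam lamo \<theta> L Lo X \<longleftrightarrow>
     prob_space.indep_vars M (\<lambda>_. borel) X sources \<and>
     distributed M lborel (X Horizon) (exponential_density \<theta>) \<and>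
     (\<forall>i\<ge>1. distributed M lborel (X (DefaultWait i)) (exponential_density (lam i)) \<and>
            distr M borel (X (DefaultLoss i)) = distr M borel L) \<and>
     (\<forall>i\<ge>1. \<forall>k. distributed M lborel (X (OtherWait i k)) (exponential_density (lamo i)) \<and>
                distr M borel (X (OtherLoss i k)) = distr M borel Lo)"

text \<open>
  \<open>default_time X n i \<omega>\<close> is the time at which the number of obligors, initially \<open>n\<close>, drops from
  \<open>i\<close> to \<open>i - 1\<close>. The phase with \<open>i\<close> obligors is thus the time interval from
  \<open>default_time X n (Suc i) \<omega>\<close> to \<open>default_time X n i \<omega>\<close>, starting at \<open>0\<close> for \<open>i = n\<close>.
\<close>

definition default_time :: "(source \<Rightarrow> 'a \<Rightarrow> real) \<Rightarrow> nat \<Rightarrow> nat \<Rightarrow> 'a \<Rightarrow> real" where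
  "default_time X n i \<omega> = (\<Sum>j\<in>{i..n}. X (DefaultWait j) \<omega>)"

definition other_time :: "(source \<Rightarrow> 'a \<Rightarrow> real) \<Rightarrow> nat \<Rightarrow> nat \<Rightarrow> nat \<Rightarrow> 'a \<Rightarrow> real" where
  "other_time X n i k \<omega> = default_time X n (Suc i) \<omega> + (\<Sum>m\<le>k. X (OtherWait i m) \<omega>)"

text \<open>
  The difference of the two minima is the time spent in phase \<open>i\<close> up to time \<open>s\<close>. The index set of
  the last sum is almost surely finite, as only finitely many non-default events fall in a phase.
\<close>

definition reserve ::
  "(source \<Rightarrow> 'a \<Rightarrow> real) \<Rightarrow> (nat \<Rightarrow> real) \<Rightarrow> nat \<Rightarrow> real \<Rightarrow> real \<Rightarrow> 'a \<Rightarrow> real" where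
  "reserve X r n u s \<omega> =
     u + (\<Sum>i=1..n. r i * (min s (default_time X n i \<omega>) - min s (default_time X n (Suc i) \<omega>)))
       - (\<Sum>i | i \<in> {1..n} \<and> default_time X n i \<omega> \<le> s. X (DefaultLoss i) \<omega>)
       - (\<Sum>i=1..n. \<Sum>k | other_time X n i k \<omega> \<le> s \<and> other_time X n i k \<omega> < default_time X n i \<omega>.
                       X (OtherLoss i k) \<omega>)"

definition net_loss ::
  "(source \<Rightarrow> 'a \<Rightarrow> real) \<Rightarrow> (nat \<Rightarrow> real) \<Rightarrow> nat \<Rightarrow> real \<Rightarrow> real \<Rightarrow> 'a \<Rightarrow> real" where
  "net_loss X r n u s \<omega> = u - reserve X r n u s \<omega>"

lemma net_loss_initial_reserve: "net_loss X r n u s \<omega> = net_loss X r n v s \<omega>"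
  by (simp add: net_loss_def reserve_def)

text \<open>
  In view of \<open>net_loss_initial_reserve\<close> the initial reserve may be taken to be \<open>0\<close> here.
\<close>

definition max_net_loss :: "(source \<Rightarrow> 'a \<Rightarrow> real) \<Rightarrow> (nat \<Rightarrow> real) \<Rightarrow> nat \<Rightarrow> 'a \<Rightarrow> real" where
  "max_net_loss X r n \<omega> = (SUP s\<in>{0..X Horizon \<omega>}. net_loss X r n 0 s \<omega>)"

text \<open>
  The completion only matters on null sets, where the paths can be ill-behaved (negative waiting
  times, accumulating events) and the measurability of the supremum over an uncountable set of
  times could fail.
\<close>

definition ruin_prob ::
  "'a measure \<Rightarrow> (source \<Rightarrow> 'a \<Rightarrow> real) \<Rightarrow> (nat \<Rightarrow> real) \<Rightarrow> nat \<Rightarrow> real \<Rightarrow> real" where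
  "ruin_prob M X r n u = measure (completion M) {\<omega> \<in> space M. max_net_loss X r n \<omega> \<ge> u}"

definition ruin_transform ::
  "'a measure \<Rightarrow> (source \<Rightarrow> 'a \<Rightarrow> real) \<Rightarrow> (nat \<Rightarrow> real) \<Rightarrow> nat \<Rightarrow> real \<Rightarrow> real" where
  "ruin_transform M X r n \<gamma> = (LBINT u:{0<..}. exp (- \<gamma> * u) * ruin_prob M X r n u)"

definition laplace :: "'a measure \<Rightarrow> ('a \<Rightarrow> real) \<Rightarrow> real \<Rightarrow> real" where
  "laplace M L \<gamma> = (LINT \<omega>|M. exp (- \<gamma> * L \<omega>))"

definition B :: "'a measure \<Rightarrow> ('a \<Rightarrow> real) \<Rightarrow> real \<Rightarrow> real \<Rightarrow> real" where
  "B M L x y = laplace M L x * (1 / x - y)"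

end

theory Submission
  imports Defs "HOL-Real_Asymp.Real_Asymp"
begin

text \<open>
  The transform equation is the Laplace transform of a fixed-point equation in law, obtained by
  conditioning on the first event of phase \<open>n\<close>. Write \<open>Z n\<close> for the peak of the net loss, \<open>\<kappa>\<close> for
  \<open>lam n + lamo n + \<theta>\<close> and \<open>c\<close> for \<open>r n\<close>. Before the first default, non-default loss or horizon the
  net loss decreases at rate \<open>c\<close> from \<open>0\<close>. Hence \<open>Z n = 0\<close> if the horizon comes first. If an event
  at time \<open>t\<close> with loss \<open>l\<close> comes first, then \<open>Z n = max 0 (l - c * t + Z')\<close>, where \<open>Z'\<close> is the peak
  of the path restarted at \<open>t\<close>, with \<open>n - 1\<close> obligors after a default and \<open>n\<close> obligors otherwise.
  By memorylessness \<open>Z'\<close> is independent of \<open>(t, l)\<close> and has the law of \<open>Z (n - 1)\<close> or \<open>Z n\<close>.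
  The integral over the exponential time \<open>t\<close> of \<open>exp (- \<gamma> * max 0 (y - c * t))\<close> combines the two
  exponentials \<open>exp (- \<gamma> * y)\<close> and \<open>exp (- (\<kappa> / c) * y)\<close>, which is where the second argument
  \<open>\<kappa> / c\<close> of the transform comes from; since \<open>l\<close> and \<open>Z'\<close> are independent, the expectation over
  \<open>y = l + Z'\<close> factorises into the loss transform and the transform of \<open>Z'\<close>. Finally
  \<open>\<psi> n \<gamma> = (1 - E (exp (- \<gamma> * Z n))) / \<gamma>\<close> by Fubini.

  All this is carried out on the product space of the laws of the primitive variables. The pathwise
  recursion is \<open>peak_default_first\<close> and \<open>peak_other_first\<close>. Counting only finitely many
  events turns this recursion into an approximation that is visibly measurable and that is
  eventually exact on almost every path (\<open>peak_approx_reaches_peak\<close>), so the supremum over uncountably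
  many times has a measurable version. The regeneration in law is \<open>memoryless_coordinate\<close>, which
  resamples a single exponential coordinate; together with the invariance of the product law under
  dropping the first non-default event it gives \<open>nn_integral_default_first\<close> and
  \<open>nn_integral_other_first\<close>, and from there \<open>peak_transform_recursion\<close>.
\<close>

section \<open>The path up to its first event\<close>

abbreviation (input) coord :: "source \<Rightarrow> (source \<Rightarrow> real) \<Rightarrow> real" where
  "coord \<equiv> \<lambda>q x. x q"

abbreviation path_loss :: "(nat \<Rightarrow> real) \<Rightarrow> nat \<Rightarrow> real \<Rightarrow> (source \<Rightarrow> real) \<Rightarrow> real" where
  "path_loss r n \<equiv> net_loss coord r n 0"

abbreviation peak :: "(nat \<Rightarrow> real) \<Rightarrow> nat \<Rightarrow> (source \<Rightarrow> real) \<Rightarrow> real" where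
  "peak \<equiv> max_net_loss coord"

text \<open>
  The almost sure properties on which the pathwise recursion rests. Positive waiting times make the
  net loss decrease on a nontrivial interval before the first event, so that \<open>0\<close> is always a
  candidate for the peak; divergent arrival times keep the number of events in a phase finite.
\<close>

definition admissible :: "(source \<Rightarrow> real) \<Rightarrow> bool" where
  "admissible x \<longleftrightarrow> 0 \<le> x Horizon \<and> (\<forall>i\<ge>1. 0 < x (DefaultWait i)) \<and>
     (\<forall>i\<ge>1. \<forall>k. 0 < x (OtherWait i k)) \<and>
     (\<forall>i\<ge>1. \<forall>N::nat. \<exists>k. real N < (\<Sum>m\<le>k. x (OtherWait i m)))"

text \<open>
  The sources seen by an observer who restarts the clock at the first default. The spent variables of
  phase \<open>n\<close> stay in place, as the model with \<open>n - 1\<close> obligors does not read them.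
\<close>

definition skip_default :: "nat \<Rightarrow> (source \<Rightarrow> real) \<Rightarrow> source \<Rightarrow> real" where
  "skip_default n x = x(Horizon := x Horizon - x (DefaultWait n))"

text \<open>
  Restarting the clock at the first non-default event of phase \<open>n\<close> renumbers the later ones. The
  renumbering misses \<open>OtherLoss n 0\<close>, so the restarted path is independent of the loss just suffered.
\<close>

definition shift_source :: "nat \<Rightarrow> source \<Rightarrow> source" where
  "shift_source n q = (case q of
     OtherWait i k \<Rightarrow> OtherWait i (if i = n then Suc k else k)
   | OtherLoss i k \<Rightarrow> OtherLoss i (if i = n then Suc k else k)
   | _ \<Rightarrow> q)"

definition drop_first :: "nat \<Rightarrow> (source \<Rightarrow> real) \<Rightarrow> source \<Rightarrow> real" where
  "drop_first n x = (\<lambda>q\<in>sources. x (shift_source n q))"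

definition skip_other :: "nat \<Rightarrow> (source \<Rightarrow> real) \<Rightarrow> source \<Rightarrow> real" where
  "skip_other n x = (drop_first n x)
     (Horizon := x Horizon - x (OtherWait n 0),
      DefaultWait n := x (DefaultWait n) - x (OtherWait n 0))"

lemma sources_iff [simp]:
  "Horizon \<in> sources"
  "DefaultWait i \<in> sources \<longleftrightarrow> i \<ge> 1"
  "DefaultLoss i \<in> sources \<longleftrightarrow> i \<ge> 1"
  "OtherWait i k \<in> sources \<longleftrightarrow> i \<ge> 1"
  "OtherLoss i k \<in> sources \<longleftrightarrow> i \<ge> 1"
  by (auto simp: sources_def)

lemma shift_source_in_sources: "q \<in> sources \<Longrightarrow> shift_source n q \<in> sources"
  by (cases q) (auto simp: shift_source_def)

lemma inj_shift_source: "inj_on (shift_source n) A"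
  by (auto simp: inj_on_def shift_source_def split: source.splits if_splits)

lemma skip_other_simps:
  assumes "n \<ge> 1"
  shows "skip_other n x Horizon = x Horizon - x (OtherWait n 0)"
    "skip_other n x (DefaultWait n) = x (DefaultWait n) - x (OtherWait n 0)"
    "i \<ge> 1 \<Longrightarrow> i \<noteq> n \<Longrightarrow> skip_other n x (DefaultWait i) = x (DefaultWait i)"
    "i \<ge> 1 \<Longrightarrow> skip_other n x (DefaultLoss i) = x (DefaultLoss i)"
    "skip_other n x (OtherWait n k) = x (OtherWait n (Suc k))"
    "skip_other n x (OtherLoss n k) = x (OtherLoss n (Suc k))"
    "i \<ge> 1 \<Longrightarrow> i \<noteq> n \<Longrightarrow> skip_other n x (OtherWait i k) = x (OtherWait i k)"
    "i \<ge> 1 \<Longrightarrow> i \<noteq> n \<Longrightarrow> skip_other n x (OtherLoss i k) = x (OtherLoss i k)"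
  using assms by (auto simp: skip_other_def drop_first_def shift_source_def)

lemma admissible_skip_default:
  "admissible x \<Longrightarrow> x (DefaultWait n) \<le> x Horizon \<Longrightarrow> admissible (skip_default n x)"
  by (auto simp: admissible_def skip_default_def)

lemma admissible_skip_other:
  assumes "admissible x" "n \<ge> 1" "x (OtherWait n 0) < x (DefaultWait n)"
    "x (OtherWait n 0) \<le> x Horizon"
  shows "admissible (skip_other n x)"
proof -
  have "\<exists>k. real N < (\<Sum>m\<le>k. skip_other n x (OtherWait i m))" if i: "i \<ge> 1" for i N
  proof (cases "i = n")
    case True
    obtain j :: nat where j: "real N + x (OtherWait n 0) < j"
      using reals_Archimedean2 by blast
    obtain k where k: "real j < (\<Sum>m\<le>k. x (OtherWait n m))"
      using assms(1,2) unfolding admissible_def by blast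
    also have "\<dots> \<le> (\<Sum>m\<le>Suc k. x (OtherWait n m))"
      using assms(1,2) unfolding admissible_def by (simp add: less_imp_le)
    also have "\<dots> = x (OtherWait n 0) + (\<Sum>m\<le>k. x (OtherWait n (Suc m)))"
      by (subst sum.atMost_Suc_shift) simp
    finally show ?thesis using j True assms(2)
      by (intro exI[of _ k]) (simp add: skip_other_simps)
  next
    case False
    then show ?thesis using assms(1,2) i by (simp add: skip_other_simps admissible_def)
  qed
  moreover have "0 < skip_other n x (DefaultWait i)" if "i \<ge> 1" for i
    using assms that by (cases "i = n") (auto simp: skip_other_simps admissible_def)
  moreover have "0 < skip_other n x (OtherWait i k)" if "i \<ge> 1" for i k
    using assms that by (cases "i = n") (auto simp: skip_other_simps admissible_def)
  ultimately show ?thesis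
    using assms by (auto simp: admissible_def skip_other_simps)
qed

lemma net_loss_eq:
  "net_loss X r n 0 s \<omega> =
     (\<Sum>i | i \<in> {1..n} \<and> default_time X n i \<omega> \<le> s. X (DefaultLoss i) \<omega>)
     + (\<Sum>i=1..n. \<Sum>k | other_time X n i k \<omega> \<le> s \<and> other_time X n i k \<omega> < default_time X n i \<omega>.
                       X (OtherLoss i k) \<omega>)
     - (\<Sum>i=1..n. r i * (min s (default_time X n i \<omega>) - min s (default_time X n (Suc i) \<omega>)))"
  by (simp add: net_loss_def reserve_def)

text \<open>
  The peak is a function of the family of sources alone, which allows to move from the given
  probability space to the product space.
\<close>

lemma max_net_loss_restrict:
  "max_net_loss X r n \<omega> = peak r n (\<lambda>q\<in>sources. X q \<omega>)"
proof -
  have dt: "default_time coord n i (\<lambda>q\<in>sources. X q \<omega>) = default_time X n i \<omega>" if "i \<ge> 1" for i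
    unfolding default_time_def using that by (intro sum.cong) auto
  have ot: "other_time coord n i k (\<lambda>q\<in>sources. X q \<omega>) = other_time X n i k \<omega>" if "i \<ge> 1" for i k
    unfolding other_time_def using that dt[of "Suc i"] by (simp add: dt)
  have "net_loss coord r n 0 s (\<lambda>q\<in>sources. X q \<omega>) = net_loss X r n 0 s \<omega>" for s
    unfolding net_loss_eq
    by (intro arg_cong2[where f="(+)"] arg_cong2[where f="(-)"] sum.cong)
       (auto simp: dt ot intro!: sum.cong)
  then show ?thesis by (simp add: max_net_loss_def)
qed

lemma default_time_top [simp]: "default_time X n (Suc n) \<omega> = 0"
  by (simp add: default_time_def)

lemma default_time_self [simp]: "default_time X n n \<omega> = X (DefaultWait n) \<omega>"
  by (simp add: default_time_def)

lemma default_time_ge: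
  assumes "admissible x" "1 \<le> i" "i \<le> n"
  shows "x (DefaultWait n) \<le> default_time coord n i x"
proof -
  have "(\<Sum>j\<in>{n}. x (DefaultWait j)) \<le> (\<Sum>j\<in>{i..n}. x (DefaultWait j))"
    using assms by (intro sum_mono2) (auto simp: admissible_def less_imp_le)
  then show ?thesis by (simp add: default_time_def)
qed

lemma other_time_ge:
  assumes "admissible x" "1 \<le> i"
  shows "default_time coord n (Suc i) x + x (OtherWait i 0) \<le> other_time coord n i k x"
proof -
  have "(\<Sum>j\<in>{0}. x (OtherWait i j)) \<le> (\<Sum>j\<le>k. x (OtherWait i j))"
    using assms by (intro sum_mono2) (auto simp: admissible_def less_imp_le)
  then show ?thesis by (simp add: other_time_def)
qed

lemma path_loss_before_first_event:
  assumes x: "admissible x" and n: "n \<ge> 1"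
    and s: "0 \<le> s" "s < x (DefaultWait n)" "s < x (OtherWait n 0)"
  shows "path_loss r n s x = - r n * s"
proof -
  have dt: "s < default_time coord n i x" if "1 \<le> i" "i \<le> n" for i
    using default_time_ge[OF x that] s by linarith
  have ot: "s < other_time coord n i k x" if "1 \<le> i" "i \<le> n" for i k
  proof (cases "i = n")
    case True
    then show ?thesis using other_time_ge[OF x n, of n k] s by simp
  next
    case False
    then have "s < default_time coord n (Suc i) x"
      using that by (intro dt) auto
    moreover have "0 < x (OtherWait i 0)" using x that by (auto simp: admissible_def)
    ultimately show ?thesis using other_time_ge[OF x that(1), of n k] by linarith
  qed
  have R: "(\<Sum>i=1..n. r i * (min s (default_time coord n i x) - min s (default_time coord n (Suc i) x)))
      = (\<Sum>i=1..n. if i = n then r n * s else 0)"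
  proof (intro sum.cong refl)
    fix i assume i: "i \<in> {1..n}"
    then have "s < default_time coord n i x" by (intro dt) auto
    moreover have "s < default_time coord n (Suc i) x" if "i \<noteq> n"
      using that i by (intro dt) auto
    ultimately show "r i * (min s (default_time coord n i x) - min s (default_time coord n (Suc i) x))
        = (if i = n then r n * s else 0)"
      using s by (cases "i = n") (auto simp: min_def)
  qed
  have none: "{i. i \<in> {1..n} \<and> default_time coord n i x \<le> s} = {}"
    using dt by force
  have no_other: "(\<Sum>i=1..n. \<Sum>k | other_time coord n i k x \<le> s \<and>
      other_time coord n i k x < default_time coord n i x. x (OtherLoss i k)) = 0"
    using ot by (intro sum.neutral ballI) (auto simp: not_le[symmetric])
  show ?thesis unfolding net_loss_eq none no_other R using n by simp
qed

text \<open>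
  Ties between a default and a non-default event count as a default: \<open>reserve\<close> admits a non-default
  event only strictly before the default that ends the phase.
\<close>

lemma path_loss_after_default:
  assumes x: "admissible x" and first: "x (DefaultWait (Suc m)) \<le> x (OtherWait (Suc m) 0)"
    and s: "x (DefaultWait (Suc m)) \<le> s"
  shows "path_loss r (Suc m) s x = x (DefaultLoss (Suc m)) - r (Suc m) * x (DefaultWait (Suc m))
           + path_loss r m (s - x (DefaultWait (Suc m))) (skip_default (Suc m) x)"
proof -
  let ?T = "x (DefaultWait (Suc m))" and ?y = "skip_default (Suc m) x"
  have T: "0 < ?T" using x by (simp add: admissible_def)
  have dt: "default_time coord (Suc m) i x = ?T + default_time coord m i ?y" if "i \<le> Suc m" for i
    using that by (simp add: default_time_def skip_default_def)
  have ot: "other_time coord (Suc m) i k x = ?T + other_time coord m i k ?y" if "i \<le> m" for i k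
    using that by (simp add: other_time_def dt) (simp add: skip_default_def)
  have none: "{k. other_time coord (Suc m) (Suc m) k x \<le> s \<and>
      other_time coord (Suc m) (Suc m) k x < default_time coord (Suc m) (Suc m) x} = {}"
  proof -
    have "\<not> other_time coord (Suc m) (Suc m) k x < default_time coord (Suc m) (Suc m) x" for k
      using other_time_ge[OF x, of "Suc m" "Suc m" k] first by simp
    then show ?thesis by blast
  qed
  have A: "(\<Sum>i | i \<in> {1..Suc m} \<and> default_time coord (Suc m) i x \<le> s. x (DefaultLoss i))
     = x (DefaultLoss (Suc m))
      + (\<Sum>i | i \<in> {1..m} \<and> default_time coord m i ?y \<le> s - ?T. ?y (DefaultLoss i))"
  proof -
    have "{i. i \<in> {1..Suc m} \<and> default_time coord (Suc m) i x \<le> s}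
        = insert (Suc m) {i. i \<in> {1..m} \<and> default_time coord m i ?y \<le> s - ?T}"
      using s by (auto simp: dt le_Suc_eq algebra_simps)
    then show ?thesis by (simp add: skip_default_def)
  qed
  have B: "(\<Sum>i=1..Suc m. \<Sum>k | other_time coord (Suc m) i k x \<le> s \<and>
        other_time coord (Suc m) i k x < default_time coord (Suc m) i x. x (OtherLoss i k))
      = (\<Sum>i=1..m. \<Sum>k | other_time coord m i k ?y \<le> s - ?T \<and>
        other_time coord m i k ?y < default_time coord m i ?y. ?y (OtherLoss i k))"
  proof -
    have "(\<Sum>k | other_time coord (Suc m) i k x \<le> s \<and>
        other_time coord (Suc m) i k x < default_time coord (Suc m) i x. x (OtherLoss i k))
      = (\<Sum>k | other_time coord m i k ?y \<le> s - ?T \<and>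
        other_time coord m i k ?y < default_time coord m i ?y. ?y (OtherLoss i k))"
      if "i \<in> {1..m}" for i
      using that by (intro sum.cong) (auto simp: ot dt algebra_simps, auto simp: skip_default_def)
    then show ?thesis
      by (subst sum.nat_ivl_Suc') (simp, simp only: none sum.empty add_0_left cong: sum.cong)
  qed
  have "min s (?T + a) - min s (?T + b) = min (s - ?T) a - min (s - ?T) b" for a b
    by (simp add: min_def)
  then have C: "(\<Sum>i=1..Suc m. r i * (min s (default_time coord (Suc m) i x) - min s (default_time coord (Suc m) (Suc i) x)))
     = r (Suc m) * ?T + (\<Sum>i=1..m. r i * (min (s - ?T) (default_time coord m i ?y) - min (s - ?T) (default_time coord m (Suc i) ?y)))"
    using s T by (simp add: sum.nat_ivl_Suc' dt)
  show ?thesis unfolding net_loss_eq A B C by simp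
qed

text \<open>
  Splitting off the first summand needs a finite sum of non-default losses, since a sum over an infinite
  set of events is \<open>0\<close> by convention; this is where divergence of the arrival times enters.
\<close>

lemma path_loss_after_other:
  assumes x: "admissible x" and n: "n \<ge> 1" and first: "x (OtherWait n 0) < x (DefaultWait n)"
    and s: "x (OtherWait n 0) \<le> s"
  shows "path_loss r n s x = x (OtherLoss n 0) - r n * x (OtherWait n 0)
           + path_loss r n (s - x (OtherWait n 0)) (skip_other n x)"
proof -
  let ?T = "x (OtherWait n 0)" and ?y = "skip_other n x"
  have T: "0 < ?T" using x n by (simp add: admissible_def)
  have dt: "default_time coord n i x = ?T + default_time coord n i ?y" if "i \<ge> 1" "i \<le> n" for i
  proof -
    have "{i..n} = insert n {i..<n}" using that by auto
    then show ?thesis using that n by (simp add: default_time_def skip_other_simps)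
  qed
  have ot: "other_time coord n i k x = ?T + other_time coord n i k ?y" if "i \<ge> 1" "i < n" for i k
    using that n by (simp add: other_time_def dt) (simp add: skip_other_simps)
  have otn: "other_time coord n n (Suc k) x = ?T + other_time coord n n k ?y" for k
    by (simp add: other_time_def sum.atMost_Suc_shift del: sum.atMost_Suc)
       (simp add: skip_other_simps[OF n])
  have ot0: "other_time coord n n 0 x = ?T"
    by (simp add: other_time_def)
  define K where "K = {k. other_time coord n n k ?y \<le> s - ?T \<and>
      other_time coord n n k ?y < default_time coord n n ?y}"
  have "finite K"
  proof -
    obtain j :: nat where j: "s < j" using reals_Archimedean2 by blast
    obtain k0 where k0: "real j < (\<Sum>m\<le>k0. x (OtherWait n m))"
      using x n unfolding admissible_def by blast
    have "k < k0" if "k \<in> K" for k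
    proof (rule ccontr)
      assume "\<not> k < k0"
      then have "(\<Sum>m\<le>k0. x (OtherWait n m)) \<le> (\<Sum>m\<le>Suc k. x (OtherWait n m))"
        using x n by (intro sum_mono2) (auto simp: admissible_def less_imp_le)
      also have "\<dots> = other_time coord n n (Suc k) x" by (simp add: other_time_def)
      also have "\<dots> \<le> s" using that by (simp add: otn K_def)
      finally show False using k0 j by simp
    qed
    then show ?thesis by (meson finite_nat_set_iff_bounded)
  qed
  have A: "(\<Sum>i | i \<in> {1..n} \<and> default_time coord n i x \<le> s. x (DefaultLoss i))
     = (\<Sum>i | i \<in> {1..n} \<and> default_time coord n i ?y \<le> s - ?T. ?y (DefaultLoss i))"
    using n by (intro sum.cong) (auto simp: dt skip_other_simps)
  have Bn: "(\<Sum>k | other_time coord n n k x \<le> s \<and>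
        other_time coord n n k x < default_time coord n n x. x (OtherLoss n k))
      = x (OtherLoss n 0) + (\<Sum>k\<in>K. ?y (OtherLoss n k))"
  proof -
    have "{k. other_time coord n n k x \<le> s \<and> other_time coord n n k x < default_time coord n n x}
        = insert 0 (Suc ` K)" (is "?L = ?R")
    proof (rule set_eqI)
      fix k show "k \<in> ?L \<longleftrightarrow> k \<in> ?R"
        using s first n by (cases k) (auto simp: ot0 otn K_def dt skip_other_simps)
    qed
    then show ?thesis
      using \<open>finite K\<close> n by (simp add: sum.reindex skip_other_simps)
  qed
  have Bi: "(\<Sum>k | other_time coord n i k x \<le> s \<and>
        other_time coord n i k x < default_time coord n i x. x (OtherLoss i k))
      = (\<Sum>k | other_time coord n i k ?y \<le> s - ?T \<and>
        other_time coord n i k ?y < default_time coord n i ?y. ?y (OtherLoss i k))"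
    if "1 \<le> i" "i < n" for i
    using that n by (intro sum.cong) (auto simp: ot dt skip_other_simps algebra_simps)
  have split: "{1..n} = insert n {1..<n}" using n by auto
  have B: "(\<Sum>i=1..n. \<Sum>k | other_time coord n i k x \<le> s \<and>
        other_time coord n i k x < default_time coord n i x. x (OtherLoss i k))
      = x (OtherLoss n 0) + (\<Sum>i=1..n. \<Sum>k | other_time coord n i k ?y \<le> s - ?T \<and>
        other_time coord n i k ?y < default_time coord n i ?y. ?y (OtherLoss i k))"
  proof -
    have "(\<Sum>i\<in>{1..<n}. \<Sum>k | other_time coord n i k x \<le> s \<and>
        other_time coord n i k x < default_time coord n i x. x (OtherLoss i k))
      = (\<Sum>i\<in>{1..<n}. \<Sum>k | other_time coord n i k ?y \<le> s - ?T \<and>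
        other_time coord n i k ?y < default_time coord n i ?y. ?y (OtherLoss i k))"
      by (intro sum.cong refl Bi) auto
    then show ?thesis
      unfolding split K_def [symmetric]
      by (simp only: sum.insert finite_atLeastLessThan atLeastLessThan_iff less_irrefl
          simp_thms Bn K_def [symmetric] add.assoc)
  qed
  have mm: "min s (?T + a) - min s (?T + b) = min (s - ?T) a - min (s - ?T) b" for a b
    by (simp add: min_def)
  have C: "(\<Sum>i=1..n. r i * (min s (default_time coord n i x) - min s (default_time coord n (Suc i) x)))
     = r n * ?T + (\<Sum>i=1..n. r i * (min (s - ?T) (default_time coord n i ?y) - min (s - ?T) (default_time coord n (Suc i) ?y)))"
    (is "_ = _ + (\<Sum>i=1..n. ?g i)")
  proof -
    have "r i * (min s (default_time coord n i x) - min s (default_time coord n (Suc i) x)) = ?g i"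
      if "1 \<le> i" "i < n" for i
      using that by (simp add: dt mm)
    then have "(\<Sum>i\<in>{1..<n}. r i * (min s (default_time coord n i x) - min s (default_time coord n (Suc i) x)))
        = (\<Sum>i\<in>{1..<n}. ?g i)"
      by (intro sum.cong) auto
    moreover have "r n * (min s (x (DefaultWait n)) - min s 0) = r n * ?T + ?g n"
      using s T first n by (simp add: skip_other_simps) (simp add: min_def algebra_simps)
    ultimately show ?thesis unfolding split by simp
  qed
  show ?thesis unfolding net_loss_eq A B C by simp
qed

text \<open>
  The peak of a path \<open>f\<close> that decreases from \<open>0\<close> up to time \<open>T\<close>, jumps, and then follows \<open>g\<close>
  from level \<open>c\<close>: it is attained at time \<open>0\<close> or after \<open>T\<close>.
\<close>

lemma Sup_regenerative_path:
  fixes f g :: "real \<Rightarrow> real"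
  assumes T: "0 < T" "T \<le> E" and \<rho>: "0 \<le> \<rho>"
    and before: "\<And>s. 0 \<le> s \<Longrightarrow> s < T \<Longrightarrow> f s = - \<rho> * s"
    and after: "\<And>s. T \<le> s \<Longrightarrow> f s = c + g (s - T)"
    and bdd: "bdd_above (g ` {0..E - T})"
  shows "bdd_above (f ` {0..E})" (is ?bdd)
    and "(SUP s\<in>{0..E}. f s) = max 0 (c + (SUP s\<in>{0..E - T}. g s))" (is "?S = ?m")
proof -
  have up: "f s \<le> ?m" if "s \<in> {0..E}" for s
  proof (cases "s < T")
    case True
    then have "f s = - (\<rho> * s)" "0 \<le> \<rho> * s" using that \<rho> by (simp_all add: before)
    then show ?thesis by simp
  next
    case False
    then have "g (s - T) \<le> (SUP s\<in>{0..E - T}. g s)"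
      using that by (intro cSUP_upper bdd) auto
    then show ?thesis using False by (simp add: after)
  qed
  then show ?bdd by (rule bdd_aboveI2)
  have "0 \<le> ?S"
    using cSUP_upper[OF _ \<open>?bdd\<close>, of 0] T by (simp add: before)
  moreover have "(SUP s\<in>{0..E - T}. g s) \<le> ?S - c"
  proof (rule cSUP_least)
    fix s assume "s \<in> {0..E - T}"
    then have "f (s + T) \<le> ?S"
      using T by (intro cSUP_upper \<open>?bdd\<close>) auto
    then show "g s \<le> ?S - c"
      using after[of "s + T"] \<open>s \<in> {0..E - T}\<close> by simp
  qed (use T in auto)
  moreover have "?S \<le> ?m"
    by (rule cSUP_least) (use T up in auto)
  ultimately show "?S = ?m" by (intro antisym) auto
qed

lemma max_net_loss_0: "X Horizon \<omega> \<ge> 0 \<Longrightarrow> max_net_loss X r 0 \<omega> = 0"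
  by (simp add: max_net_loss_def net_loss_eq)

lemma peak_no_event:
  assumes "admissible x" "n \<ge> 1" "r n \<ge> 0"
    "x Horizon < x (DefaultWait n)" "x Horizon < x (OtherWait n 0)"
  shows "bdd_above ((\<lambda>s. path_loss r n s x) ` {0..x Horizon})" "peak r n x = 0"
proof -
  have *: "path_loss r n s x = - r n * s" if "s \<in> {0..x Horizon}" for s
    using assms that by (intro path_loss_before_first_event) auto
  show "bdd_above ((\<lambda>s. path_loss r n s x) ` {0..x Horizon})"
    using * assms by (intro bdd_aboveI2[where M = 0]) auto
  have "0 \<le> x Horizon" using assms by (simp add: admissible_def)
  then show "peak r n x = 0"
    unfolding max_net_loss_def using * assms by (intro cSup_eq_maximum) (force, auto)
qed

lemma peak_default_first:
  assumes "admissible x" "r (Suc m) \<ge> 0"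
    "x (DefaultWait (Suc m)) \<le> x (OtherWait (Suc m) 0)" "x (DefaultWait (Suc m)) \<le> x Horizon"
    "bdd_above ((\<lambda>s. path_loss r m s (skip_default (Suc m) x)) ` {0..skip_default (Suc m) x Horizon})"
  shows "bdd_above ((\<lambda>s. path_loss r (Suc m) s x) ` {0..x Horizon})"
    "peak r (Suc m) x = max 0 (x (DefaultLoss (Suc m)) - r (Suc m) * x (DefaultWait (Suc m))
       + peak r m (skip_default (Suc m) x))"
proof -
  have H: "skip_default (Suc m) x Horizon = x Horizon - x (DefaultWait (Suc m))"
    by (simp add: skip_default_def)
  have T: "0 < x (DefaultWait (Suc m))" using assms(1) by (simp add: admissible_def)
  have before: "path_loss r (Suc m) s x = - r (Suc m) * s"
    if "0 \<le> s" "s < x (DefaultWait (Suc m))" for s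
    using assms that by (intro path_loss_before_first_event) auto
  note S = Sup_regenerative_path[where f = "\<lambda>s. path_loss r (Suc m) s x",
      OF T assms(4,2) before path_loss_after_default[OF assms(1,3)] assms(5)[unfolded H]]
  show "bdd_above ((\<lambda>s. path_loss r (Suc m) s x) ` {0..x Horizon})" by (rule S(1))
  show "peak r (Suc m) x = max 0 (x (DefaultLoss (Suc m)) - r (Suc m) * x (DefaultWait (Suc m))
       + peak r m (skip_default (Suc m) x))"
    unfolding max_net_loss_def H by (rule S(2))
qed

lemma peak_other_first:
  assumes "admissible x" "r n \<ge> 0" "n \<ge> 1"
    "x (OtherWait n 0) < x (DefaultWait n)" "x (OtherWait n 0) \<le> x Horizon"
    "bdd_above ((\<lambda>s. path_loss r n s (skip_other n x)) ` {0..skip_other n x Horizon})"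
  shows "bdd_above ((\<lambda>s. path_loss r n s x) ` {0..x Horizon})"
    "peak r n x = max 0 (x (OtherLoss n 0) - r n * x (OtherWait n 0) + peak r n (skip_other n x))"
proof -
  have H: "skip_other n x Horizon = x Horizon - x (OtherWait n 0)"
    using assms by (simp add: skip_other_simps)
  have T: "0 < x (OtherWait n 0)" using assms by (simp add: admissible_def)
  have before: "path_loss r n s x = - r n * s" if "0 \<le> s" "s < x (OtherWait n 0)" for s
    using assms that by (intro path_loss_before_first_event) auto
  note S = Sup_regenerative_path[where f = "\<lambda>s. path_loss r n s x",
      OF T assms(5,2) before path_loss_after_other[OF assms(1,3,4)] assms(6)[unfolded H]]
  show "bdd_above ((\<lambda>s. path_loss r n s x) ` {0..x Horizon})" by (rule S(1))
  show "peak r n x = max 0 (x (OtherLoss n 0) - r n * x (OtherWait n 0) + peak r n (skip_other n x))"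
    unfolding max_net_loss_def H by (rule S(2))
qed

section \<open>A measurable version of the peak\<close>

text \<open>
  The pathwise recursion run for at most \<open>k\<close> events. Unlike the supremum over all times, it is built
  from finitely many measurable operations.
\<close>

primrec peak_approx :: "(nat \<Rightarrow> real) \<Rightarrow> nat \<Rightarrow> nat \<Rightarrow> (source \<Rightarrow> real) \<Rightarrow> real" where
  "peak_approx r 0 n x = 0"
| "peak_approx r (Suc k) n x =
     (if n = 0 \<or> x Horizon < x (DefaultWait n) \<and> x Horizon < x (OtherWait n 0) then 0
      else if x (DefaultWait n) \<le> x (OtherWait n 0) then
        max 0 (x (DefaultLoss n) - r n * x (DefaultWait n) + peak_approx r k (n - 1) (skip_default n x))
      else max 0 (x (OtherLoss n 0) - r n * x (OtherWait n 0) + peak_approx r k n (skip_other n x)))"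

text \<open>
  The sequence is eventually constant on admissible paths; elsewhere the value of \<open>lim\<close> is arbitrary.
\<close>

definition peak_version :: "(nat \<Rightarrow> real) \<Rightarrow> nat \<Rightarrow> (source \<Rightarrow> real) \<Rightarrow> real" where
  "peak_version r n x = lim (\<lambda>k. peak_approx r k n x)"

lemma peak_approx_0: "peak_approx r k 0 x = 0"
  by (cases k) auto

text \<open>
  Each default lowers the number of obligors, and each non-default event lowers the number of
  arrivals that fit before the horizon, so a lexicographic induction follows the finitely many events
  of the path. Boundedness has to be carried along, because the supremum of an unbounded set would
  obey no recursion.
\<close>

lemma peak_approx_reaches_peak:
  assumes r: "\<forall>i\<ge>1. 0 \<le> r i" and "admissible x"
  shows "bdd_above ((\<lambda>s. path_loss r n s x) ` {0..x Horizon}) \<and>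
    (\<forall>\<^sub>F k in sequentially. peak_approx r k n x = peak r n x)"
  using assms(2)
proof (induction n arbitrary: x)
  case 0
  then show ?case
    by (auto simp: net_loss_eq peak_approx_0 max_net_loss_0 admissible_def)
next
  case (Suc m)
  note outer = Suc.IH
  have rn: "r (Suc m) \<ge> 0" by (simp add: r)
  obtain j :: nat where "x Horizon < j" using reals_Archimedean2 by blast
  moreover obtain K where "real j < (\<Sum>k\<le>K. x (OtherWait (Suc m) k))"
    using Suc.prems unfolding admissible_def by (metis One_nat_def Suc_le_mono le0)
  ultimately have "x Horizon < (\<Sum>k\<le>K. x (OtherWait (Suc m) k))" by linarith
  with Suc.prems show ?case
  proof (induction K arbitrary: x)
    case (0 x)
    show ?case
    proof (cases "x Horizon < x (DefaultWait (Suc m))")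
      case True
      then show ?thesis using 0
        by (subst eventually_sequentially_Suc [symmetric]) (auto simp: peak_no_event rn)
    next
      case False
      then have first: "x (DefaultWait (Suc m)) \<le> x (OtherWait (Suc m) 0)"
        "x (DefaultWait (Suc m)) \<le> x Horizon" using 0 by auto
      note IH = outer[OF admissible_skip_default[OF 0(1) first(2)]]
      note step = peak_default_first[OF 0(1) rn first conjunct1[OF IH]]
      show ?thesis
        using step(1) first conjunct2[OF IH]
        by (subst eventually_sequentially_Suc [symmetric])
           (auto elim!: eventually_mono simp: step(2) simp del: eventually_sequentially_Suc)
    qed
  next
    case (Suc K x)
    consider (none) "x Horizon < x (DefaultWait (Suc m))" "x Horizon < x (OtherWait (Suc m) 0)"
      | (default) "x (DefaultWait (Suc m)) \<le> x (OtherWait (Suc m) 0)"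
        "x (DefaultWait (Suc m)) \<le> x Horizon"
      | (other) "x (OtherWait (Suc m) 0) < x (DefaultWait (Suc m))"
        "x (OtherWait (Suc m) 0) \<le> x Horizon"
      by linarith
    then show ?case
    proof cases
      case none
      then show ?thesis using Suc.prems
        by (subst eventually_sequentially_Suc [symmetric]) (auto simp: peak_no_event rn)
    next
      case first: default
      note IH = outer[OF admissible_skip_default[OF Suc.prems(1) first(2)]]
      note step = peak_default_first[OF Suc.prems(1) rn first conjunct1[OF IH]]
      show ?thesis
        using step(1) first conjunct2[OF IH]
        by (subst eventually_sequentially_Suc [symmetric])
           (auto elim!: eventually_mono simp: step(2) simp del: eventually_sequentially_Suc)
    next
      case first: other
      have n: "Suc m \<ge> 1" by simp
      have "skip_other (Suc m) x Horizon < (\<Sum>k\<le>K. skip_other (Suc m) x (OtherWait (Suc m) k))"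
        using Suc.prems(2)
        by (simp add: skip_other_simps sum.atMost_Suc_shift del: sum.atMost_Suc)
      note IH = Suc.IH[OF admissible_skip_other[OF Suc.prems(1) n first] this]
      note step = peak_other_first[OF Suc.prems(1) rn n first conjunct1[OF IH]]
      show ?thesis
        using step(1) first conjunct2[OF IH]
        by (subst eventually_sequentially_Suc [symmetric])
           (auto elim!: eventually_mono simp: step(2) simp del: eventually_sequentially_Suc)
    qed
  qed
qed

lemma peak_version_eq:
  assumes "\<forall>i\<ge>1. 0 \<le> r i" "admissible x"
  shows "peak_version r n x = peak r n x"
  unfolding peak_version_def
  using peak_approx_reaches_peak[OF assms, of n]
  by (intro limI tendsto_eventually) auto

lemma peak_version_nonneg:
  assumes "\<forall>i\<ge>1. 0 \<le> r i" "admissible x"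
  shows "0 \<le> peak_version r n x"
proof -
  have "0 \<le> peak_approx r k n x" for k by (cases k) auto
  moreover have "\<forall>\<^sub>F k in sequentially. peak_approx r k n x = peak r n x"
    using peak_approx_reaches_peak[OF assms] by blast
  then have "\<exists>k. peak_approx r k n x = peak r n x"
    by (rule eventually_happens'[rotated]) simp
  ultimately show ?thesis using assms by (metis peak_version_eq)
qed

lemma peak_version_step:
  assumes r: "\<forall>i\<ge>1. 0 \<le> r i" and x: "admissible x" and n: "n \<ge> 1"
  shows "peak_version r n x =
     (if x Horizon < x (DefaultWait n) \<and> x Horizon < x (OtherWait n 0) then 0
      else if x (DefaultWait n) \<le> x (OtherWait n 0) then
        max 0 (x (DefaultLoss n) - r n * x (DefaultWait n) + peak_version r (n - 1) (skip_default n x))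
      else max 0 (x (OtherLoss n 0) - r n * x (OtherWait n 0) + peak_version r n (skip_other n x)))"
proof -
  obtain m where m: "n = Suc m" using n by (cases n) auto
  note ok = peak_version_eq[OF r] peak_approx_reaches_peak[OF r, THEN conjunct1]
  consider (none) "x Horizon < x (DefaultWait n)" "x Horizon < x (OtherWait n 0)"
    | (default) "x (DefaultWait n) \<le> x (OtherWait n 0)" "x (DefaultWait n) \<le> x Horizon"
    | (other) "x (OtherWait n 0) < x (DefaultWait n)" "x (OtherWait n 0) \<le> x Horizon"
    by linarith
  then show ?thesis
  proof cases
    case none
    then show ?thesis using n r x by (simp add: ok peak_no_event)
  next
    case default
    have y: "admissible (skip_default (Suc m) x)"
      using x default(2) unfolding m by (rule admissible_skip_default)
    show ?thesis
      using x default r peak_default_first(2)[of x r m] ok(2)[OF y] m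
      by (auto simp: ok(1)[OF x] ok(1)[OF y])
  next
    case other
    have y: "admissible (skip_other n x)" using x n other by (rule admissible_skip_other)
    show ?thesis
      using x other r n peak_other_first(2)[of x r n] ok(2)[OF y]
      by (auto simp: ok(1)[OF x] ok(1)[OF y])
  qed
qed

text \<open>
  This is what makes the path restarted at a default independent of the phase just left.
\<close>

lemma peak_approx_cong:
  assumes "x Horizon = y Horizon"
    and "\<And>i. 1 \<le> i \<Longrightarrow> i \<le> n \<Longrightarrow> x (DefaultWait i) = y (DefaultWait i) \<and>
      x (DefaultLoss i) = y (DefaultLoss i) \<and>
      (\<forall>k. x (OtherWait i k) = y (OtherWait i k) \<and> x (OtherLoss i k) = y (OtherLoss i k))"
  shows "peak_approx r k n x = peak_approx r k n y"
  using assms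
proof (induction k arbitrary: n x y)
  case (Suc k)
  show ?case
  proof (cases "n = 0")
    case False
    then have n: "1 \<le> n" by simp
    have "peak_approx r k (n - 1) (skip_default n x) = peak_approx r k (n - 1) (skip_default n y)"
      by (rule Suc.IH) (use Suc.prems n in \<open>auto simp: skip_default_def\<close>)
    moreover have "peak_approx r k n (skip_other n x) = peak_approx r k n (skip_other n y)"
      by (rule Suc.IH) (use Suc.prems n in \<open>auto simp: skip_other_def drop_first_def shift_source_def\<close>)
    ultimately show ?thesis using Suc.prems n by simp
  qed simp
qed simp

lemma peak_version_upd:
  assumes "m < n"
  shows "peak_version r m (x(DefaultWait n := t)) = peak_version r m x"
    "peak_version r m (x(DefaultLoss n := t)) = peak_version r m x"
    "peak_version r m (x(OtherWait n k := t)) = peak_version r m x"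
  using assms unfolding peak_version_def by (auto intro!: arg_cong[where f = lim] peak_approx_cong)

section \<open>Exponential waiting times\<close>

definition expo :: "real \<Rightarrow> real measure" where
  "expo \<rho> = density lborel (\<lambda>t. ennreal (exponential_density \<rho> t))"

lemma sets_expo [simp, measurable_cong]: "sets (expo \<rho>) = sets borel"
  by (simp add: expo_def)

lemma prob_space_expo: "0 < \<rho> \<Longrightarrow> prob_space (expo \<rho>)"
  unfolding expo_def by (rule prob_space_exponential_density)

lemma nn_integral_expo:
  assumes [measurable]: "f \<in> borel_measurable borel"
  shows "(\<integral>\<^sup>+t. f t \<partial>expo \<rho>) = (\<integral>\<^sup>+t. ennreal (exponential_density \<rho> t) * f t \<partial>lborel)"
  unfolding expo_def by (subst nn_integral_density) auto

lemma AE_expo_pos: "AE t in expo \<rho>. 0 < t"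
proof -
  have "AE t in lborel. t \<noteq> (0::real)" by (rule AE_lborel_singleton)
  then show ?thesis
    unfolding expo_def by (subst AE_density) (auto elim!: eventually_mono simp: exponential_density_def)
qed

text \<open>
  Both forms of the comparison occur, since the first event is found by comparing waiting times
  once strictly and once weakly.
\<close>

lemma expo_memoryless:
  assumes \<rho>: "0 < \<rho>" and a: "0 \<le> a" and cmp: "cmp = (\<le>) \<or> cmp = (<)"
    and [measurable]: "f \<in> borel_measurable borel"
  shows "(\<integral>\<^sup>+t. (if cmp a t then f (t - a) else 0) \<partial>expo \<rho>) = ennreal (exp (- \<rho> * a)) * (\<integral>\<^sup>+t. f t \<partial>expo \<rho>)"
proof -
  have m: "{t. cmp a t} \<in> sets (borel :: real measure)"
    using cmp by (elim disjE) simp_all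
  have [measurable]: "(\<lambda>t. if cmp a t then f (t - a) else 0) \<in> borel_measurable borel"
    using m by (intro measurable_If) auto
  have "(\<integral>\<^sup>+t. (if cmp a t then f (t - a) else 0) \<partial>expo \<rho>)
      = (\<integral>\<^sup>+t. ennreal (exponential_density \<rho> (a + 1 * t)) * (if cmp a (a + 1 * t) then f (a + 1 * t - a) else 0) \<partial>lborel)"
    by (subst nn_integral_expo, simp, subst nn_integral_real_affine[where c = 1 and t = a]) auto
  also have "\<dots> = (\<integral>\<^sup>+t. ennreal (exp (- \<rho> * a)) * (ennreal (exponential_density \<rho> t) * f t) \<partial>lborel)"
  proof (rule nn_integral_cong_AE)
    have "AE t in lborel. t \<noteq> (0::real)" by (rule AE_lborel_singleton)
    then show "AE t in lborel. ennreal (exponential_density \<rho> (a + 1 * t)) * (if cmp a (a + 1 * t) then f (a + 1 * t - a) else 0)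
        = ennreal (exp (- \<rho> * a)) * (ennreal (exponential_density \<rho> t) * f t)"
    proof eventually_elim
      case (elim t)
      have "ennreal (exponential_density \<rho> (a + t)) = ennreal (exp (- \<rho> * a)) * ennreal (exponential_density \<rho> t)"
        if "0 \<le> t" using that a \<rho>
        by (simp add: exponential_density_def ennreal_mult'[symmetric] exp_add[symmetric] algebra_simps)
      then show ?case
        using elim a cmp by (cases "0 < t") (auto simp: exponential_density_def mult.assoc)
    qed
  qed
  also have "\<dots> = ennreal (exp (- \<rho> * a)) * (\<integral>\<^sup>+t. f t \<partial>expo \<rho>)"
    by (subst nn_integral_cmult) (simp_all add: nn_integral_expo)
  finally show ?thesis .
qed

lemma nn_integral_exp_tail:
  assumes "0 < \<kappa>"
  shows "(\<integral>\<^sup>+t. ennreal (exp (- \<kappa> * t)) * indicator {c..} t \<partial>lborel) = ennreal (exp (- \<kappa> * c) / \<kappa>)"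
proof -
  have "((\<lambda>t. - exp (- \<kappa> * t) / \<kappa>) \<longlongrightarrow> 0) at_top"
    using assms by real_asymp
  then have "(\<integral>\<^sup>+t. ennreal (exp (- \<kappa> * t)) * indicator {c..} t \<partial>lborel) = ennreal (0 - (- exp (- \<kappa> * c) / \<kappa>))"
    using assms by (intro nn_integral_FTC_atLeast) (auto intro!: derivative_eq_intros)
  then show ?thesis by simp
qed

text \<open>
  In a phase of reserve rate \<open>c\<close>, the level \<open>y\<close> stands for the loss at the event plus the peak
  afterwards; the peak seen from the start of the phase is then the positive part of \<open>y - c * t\<close>.
\<close>

lemma expo_transform_reflected:
  fixes b c \<rho> \<gamma> y :: real
  defines "\<kappa> \<equiv> b + \<rho>"
  assumes \<rho>: "0 < \<rho>" and b: "0 \<le> b" and c: "0 < c" and y: "0 \<le> y" and \<gamma>: "\<gamma> * c \<noteq> \<kappa>"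
  shows "(\<integral>\<^sup>+t. ennreal (exp (- b * t)) * ennreal (exp (- \<gamma> * max 0 (y - c * t))) \<partial>expo \<rho>)
    = ennreal (\<rho> * (\<gamma> * (c / \<kappa>) * exp (- (\<kappa> / c) * y) - exp (- \<gamma> * y)) / (\<gamma> * c - \<kappa>))"
proof -
  have \<kappa>: "0 < \<kappa>" using \<rho> b by (simp add: \<kappa>_def)
  define d where "d = y / c"
  have d: "0 \<le> d" "c * d = y" using c y by (auto simp: d_def)
  have "(\<integral>\<^sup>+t. ennreal (exp (- b * t)) * ennreal (exp (- \<gamma> * max 0 (y - c * t))) \<partial>expo \<rho>)
    = (\<integral>\<^sup>+t. ennreal \<rho> * (ennreal (exp ((\<gamma> * c - \<kappa>) * t - \<gamma> * y)) * indicator {0..d} t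
          + ennreal (exp (- \<kappa> * t)) * indicator {d..} t) \<partial>lborel)"
  proof (subst nn_integral_expo, simp, rule nn_integral_cong_AE)
    have "AE t in lborel. t \<noteq> d" by (rule AE_lborel_singleton)
    then show "AE t in lborel. ennreal (exponential_density \<rho> t) *
        (ennreal (exp (- b * t)) * ennreal (exp (- \<gamma> * max 0 (y - c * t))))
      = ennreal \<rho> * (ennreal (exp ((\<gamma> * c - \<kappa>) * t - \<gamma> * y)) * indicator {0..d} t
          + ennreal (exp (- \<kappa> * t)) * indicator {d..} t)"
    proof eventually_elim
      case (elim t)
      consider "t < 0" | "0 \<le> t" "t < d" | "d < t" using elim by linarith
      then show ?case
      proof cases
        case 1
        then show ?thesis using d by (simp add: exponential_density_def)
      next
        case 2
        then have "c * t \<le> y" using c d(2) by (metis less_imp_le mult_le_cancel_left_pos)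
        then show ?thesis using 2 \<rho>
          by (simp add: exponential_density_def ennreal_mult'[symmetric] exp_add[symmetric] \<kappa>_def algebra_simps)
      next
        case 3
        then have "y \<le> c * t" using c d(2) by (metis less_imp_le mult_le_cancel_left_pos)
        then show ?thesis using 3 \<rho> d
          by (simp add: exponential_density_def ennreal_mult'[symmetric] exp_add[symmetric] \<kappa>_def algebra_simps)
      qed
    qed
  qed
  also have "\<dots> = ennreal \<rho> * ((\<integral>\<^sup>+t. ennreal (exp ((\<gamma> * c - \<kappa>) * t - \<gamma> * y)) * indicator {0..d} t \<partial>lborel)
      + (\<integral>\<^sup>+t. ennreal (exp (- \<kappa> * t)) * indicator {d..} t \<partial>lborel))"
    by (subst nn_integral_cmult, simp, subst nn_integral_add) auto
  also have "(\<integral>\<^sup>+t. ennreal (exp ((\<gamma> * c - \<kappa>) * t - \<gamma> * y)) * indicator {0..d} t \<partial>lborel)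
    = ennreal (exp ((\<gamma> * c - \<kappa>) * d - \<gamma> * y) / (\<gamma> * c - \<kappa>) - exp ((\<gamma> * c - \<kappa>) * 0 - \<gamma> * y) / (\<gamma> * c - \<kappa>))"
    using d \<gamma> by (intro nn_integral_FTC_Icc) (auto intro!: derivative_eq_intros)
  also have "(\<gamma> * c - \<kappa>) * d - \<gamma> * y = - (\<kappa> / c) * y"
    using c by (simp add: d_def field_simps)
  also have "(\<integral>\<^sup>+t. ennreal (exp (- \<kappa> * t)) * indicator {d..} t \<partial>lborel) = ennreal (exp (- (\<kappa> / c) * y) / \<kappa>)"
    using nn_integral_exp_tail[OF \<kappa>, of d] by (simp add: d_def)
  also have "ennreal \<rho> * (ennreal (exp (- (\<kappa> / c) * y) / (\<gamma> * c - \<kappa>) - exp ((\<gamma> * c - \<kappa>) * 0 - \<gamma> * y) / (\<gamma> * c - \<kappa>))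
      + ennreal (exp (- (\<kappa> / c) * y) / \<kappa>))
    = ennreal (\<rho> * ((exp (- (\<kappa> / c) * y) / (\<gamma> * c - \<kappa>) - exp ((\<gamma> * c - \<kappa>) * 0 - \<gamma> * y) / (\<gamma> * c - \<kappa>))
      + exp (- (\<kappa> / c) * y) / \<kappa>))"
  proof (subst ennreal_plus[symmetric])
    have "exp ((\<gamma> * c - \<kappa>) * 0 - \<gamma> * y) = exp (- \<gamma> * y)" by simp
    moreover have "(\<gamma> * c - \<kappa>) * d = \<gamma> * y - (\<kappa> / c) * y" using c by (simp add: d_def field_simps)
    then have "0 < \<gamma> * c - \<kappa> \<Longrightarrow> - \<gamma> * y \<le> - (\<kappa> / c) * y" "\<gamma> * c - \<kappa> < 0 \<Longrightarrow> - (\<kappa> / c) * y \<le> - \<gamma> * y"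
      using d(1) mult_nonneg_nonneg[of "\<gamma> * c - \<kappa>" d] mult_nonpos_nonneg[of "\<gamma> * c - \<kappa>" d] by auto
    ultimately show "0 \<le> exp (- (\<kappa> / c) * y) / (\<gamma> * c - \<kappa>) - exp ((\<gamma> * c - \<kappa>) * 0 - \<gamma> * y) / (\<gamma> * c - \<kappa>)"
      using \<gamma> unfolding diff_divide_distrib[symmetric]
      by (cases "0 < \<gamma> * c - \<kappa>") (auto intro!: divide_nonneg_pos divide_nonpos_neg)
    show "0 \<le> exp (- (\<kappa> / c) * y) / \<kappa>" using \<kappa> by simp
    show "ennreal \<rho> * ennreal (exp (- (\<kappa> / c) * y) / (\<gamma> * c - \<kappa>) - exp ((\<gamma> * c - \<kappa>) * 0 - \<gamma> * y) / (\<gamma> * c - \<kappa>) + exp (- (\<kappa> / c) * y) / \<kappa>)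
      = ennreal (\<rho> * (exp (- (\<kappa> / c) * y) / (\<gamma> * c - \<kappa>) - exp ((\<gamma> * c - \<kappa>) * 0 - \<gamma> * y) / (\<gamma> * c - \<kappa>) + exp (- (\<kappa> / c) * y) / \<kappa>))"
      using \<rho> by (subst ennreal_mult') auto
  qed
  also have "(exp (- (\<kappa> / c) * y) / (\<gamma> * c - \<kappa>) - exp ((\<gamma> * c - \<kappa>) * 0 - \<gamma> * y) / (\<gamma> * c - \<kappa>)) + exp (- (\<kappa> / c) * y) / \<kappa>
    = (\<gamma> * (c / \<kappa>) * exp (- (\<kappa> / c) * y) - exp (- \<gamma> * y)) / (\<gamma> * c - \<kappa>)"
  proof -
    have "\<gamma> * c - \<kappa> \<noteq> 0" "\<kappa> \<noteq> 0" using \<gamma> \<kappa> by auto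
    then have "a / (\<gamma> * c - \<kappa>) - e / (\<gamma> * c - \<kappa>) + a / \<kappa> = (\<gamma> * (c / \<kappa>) * a - e) / (\<gamma> * c - \<kappa>)" for a e
      by (simp add: divide_simps) (simp add: algebra_simps)
    then show ?thesis by simp
  qed
  finally show ?thesis by (simp add: mult.assoc)
qed

lemma expo_laplace:
  assumes "0 < \<rho>" "0 \<le> b"
  shows "(\<integral>\<^sup>+t. ennreal (exp (- b * t)) \<partial>expo \<rho>) = ennreal (\<rho> / (b + \<rho>))"
proof -
  have "(\<integral>\<^sup>+t. ennreal (exp (- b * t)) \<partial>expo \<rho>)
      = (\<integral>\<^sup>+t. ennreal \<rho> * (ennreal (exp (- (b + \<rho>) * t)) * indicator {0..} t) \<partial>lborel)"
    using assms by (subst nn_integral_expo, simp, intro nn_integral_cong)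
      (auto simp: exponential_density_def ennreal_mult'[symmetric] exp_add[symmetric] algebra_simps split: split_indicator)
  also have "\<dots> = ennreal (\<rho> / (b + \<rho>))"
    using assms by (subst nn_integral_cmult, simp, subst nn_integral_exp_tail) (auto simp: ennreal_mult'[symmetric])
  finally show ?thesis .
qed

section \<open>The canonical model\<close>

text \<open>
  The laws of the sources, stripped of the probability space that carries them. Outside of
  \<open>sources\<close> nothing is known about \<open>law\<close>, so the product is taken over \<open>sources\<close> only.
\<close>

locale canonical_model =
  fixes lam lamo r :: "nat \<Rightarrow> real" and \<theta> :: real
    and D Do :: "real measure" and law :: "source \<Rightarrow> real measure"
  assumes \<theta>_pos: "0 < \<theta>"
    and lam_pos: "i \<ge> 1 \<Longrightarrow> 0 < lam i"
    and lamo_pos: "i \<ge> 1 \<Longrightarrow> 0 < lamo i"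
    and r_pos: "i \<ge> 1 \<Longrightarrow> 0 < r i"
    and prob_space_D: "prob_space D" and sets_D [simp, measurable_cong]: "sets D = sets borel"
    and prob_space_Do: "prob_space Do" and sets_Do [simp, measurable_cong]: "sets Do = sets borel"
    and law_Horizon: "law Horizon = expo \<theta>"
    and law_DefaultWait: "i \<ge> 1 \<Longrightarrow> law (DefaultWait i) = expo (lam i)"
    and law_OtherWait: "i \<ge> 1 \<Longrightarrow> law (OtherWait i k) = expo (lamo i)"
    and law_DefaultLoss: "i \<ge> 1 \<Longrightarrow> law (DefaultLoss i) = D"
    and law_OtherLoss: "i \<ge> 1 \<Longrightarrow> law (OtherLoss i k) = Do"
begin

abbreviation P :: "(source \<Rightarrow> real) measure" where
  "P \<equiv> PiM sources law"

lemmas laws = law_Horizon law_DefaultWait law_OtherWait law_DefaultLoss law_OtherLoss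

lemma sets_law: "q \<in> sources \<Longrightarrow> sets (law q) = sets borel"
  by (cases q) (auto simp: laws)

lemma prob_space_law: "q \<in> sources \<Longrightarrow> prob_space (law q)"
  by (cases q)
    (auto simp: laws prob_space_D prob_space_Do intro!: prob_space_expo \<theta>_pos lam_pos lamo_pos)

lemma prob_space_P: "prob_space P"
  by (intro prob_space_PiM prob_space_law)

lemma measurable_coord: "q \<in> sources \<Longrightarrow> (\<lambda>x. x q) \<in> borel_measurable P"
  using measurable_component_singleton[of q sources law] sets_law[of q]
  by (simp cong: measurable_cong_sets)

lemma measurable_coords [measurable (raw)]:
  "(\<lambda>x. x Horizon) \<in> borel_measurable P"
  "1 \<le> i \<Longrightarrow> (\<lambda>x. x (DefaultWait i)) \<in> borel_measurable P"
  "1 \<le> i \<Longrightarrow> (\<lambda>x. x (DefaultLoss i)) \<in> borel_measurable P"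
  "1 \<le> i \<Longrightarrow> (\<lambda>x. x (OtherWait i k)) \<in> borel_measurable P"
  "1 \<le> i \<Longrightarrow> (\<lambda>x. x (OtherLoss i k)) \<in> borel_measurable P"
  by (auto intro!: measurable_coord)

lemma measurable_upd:
  assumes "q \<in> sources" "f \<in> N \<rightarrow>\<^sub>M P" "h \<in> borel_measurable N"
  shows "(\<lambda>x. (f x)(q := h x)) \<in> N \<rightarrow>\<^sub>M P"
  using assms sets_law[of q]
  by (intro measurable_fun_upd[where J = sources]) (auto simp: insert_absorb cong: measurable_cong_sets)

lemma measurable_upds [measurable (raw)]:
  assumes "f \<in> N \<rightarrow>\<^sub>M P" "h \<in> borel_measurable N"
  shows "(\<lambda>x. (f x)(Horizon := h x)) \<in> N \<rightarrow>\<^sub>M P"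
    "1 \<le> i \<Longrightarrow> (\<lambda>x. (f x)(DefaultWait i := h x)) \<in> N \<rightarrow>\<^sub>M P"
    "1 \<le> i \<Longrightarrow> (\<lambda>x. (f x)(DefaultLoss i := h x)) \<in> N \<rightarrow>\<^sub>M P"
    "1 \<le> i \<Longrightarrow> (\<lambda>x. (f x)(OtherWait i k := h x)) \<in> N \<rightarrow>\<^sub>M P"
    "1 \<le> i \<Longrightarrow> (\<lambda>x. (f x)(OtherLoss i k := h x)) \<in> N \<rightarrow>\<^sub>M P"
  using assms by (auto intro!: measurable_upd)

lemma measurable_drop_first [measurable]: "drop_first n \<in> P \<rightarrow>\<^sub>M P"
  unfolding drop_first_def
proof (rule measurable_restrict)
  fix q assume "q \<in> sources"
  then show "(\<lambda>x. x (shift_source n q)) \<in> P \<rightarrow>\<^sub>M law q"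
    using measurable_coord[OF shift_source_in_sources] sets_law[of q]
    by (simp cong: measurable_cong_sets)
qed

lemma measurable_skip_default [measurable]: "1 \<le> n \<Longrightarrow> skip_default n \<in> P \<rightarrow>\<^sub>M P"
  unfolding skip_default_def by measurable

lemma measurable_skip_other [measurable]: "1 \<le> n \<Longrightarrow> skip_other n \<in> P \<rightarrow>\<^sub>M P"
  unfolding skip_other_def by measurable

lemma measurable_peak_approx: "peak_approx r k n \<in> borel_measurable P"
proof (induction k arbitrary: n)
  case 0
  have "peak_approx r 0 n = (\<lambda>_. 0)" by (simp add: fun_eq_iff)
  then show ?case by simp
next
  case (Suc k)
  note [measurable] = Suc.IH
  show ?case
  proof (cases "n = 0")
    case True
    then have "peak_approx r (Suc k) n = (\<lambda>_. 0)" by (simp add: fun_eq_iff)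
    then show ?thesis by simp
  next
    case False
    then have [simp]: "1 \<le> n" "Suc 0 \<le> n" by simp_all
    have [measurable]: "(\<lambda>x. peak_approx r k (n - 1) (skip_default n x)) \<in> borel_measurable P"
      "(\<lambda>x. peak_approx r k n (skip_other n x)) \<in> borel_measurable P"
      by (rule measurable_compose[OF measurable_skip_default Suc.IH], simp,
          rule measurable_compose[OF measurable_skip_other Suc.IH], simp)
    have "(\<lambda>x. peak_approx r (Suc k) n x) \<in> borel_measurable P"
      using False unfolding peak_approx.simps by simp
    then show ?thesis by simp
  qed
qed

lemma measurable_peak_version [measurable]: "peak_version r n \<in> borel_measurable P"
  using measurable_peak_approx unfolding peak_version_def by measurable

text \<open>
  In a product of laws, a coordinate is independent of the others, so a fresh copy may replace it.
\<close>

lemma resample: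
  assumes q: "q \<in> sources" and [measurable]: "f \<in> borel_measurable P"
  shows "(\<integral>\<^sup>+x. f x \<partial>P) = (\<integral>\<^sup>+x. (\<integral>\<^sup>+t. f (x(q := t)) \<partial>law q) \<partial>P)" (is "_ = ?L")
    "(\<integral>\<^sup>+x. f x \<partial>P) = (\<integral>\<^sup>+t. (\<integral>\<^sup>+x. f (x(q := t)) \<partial>P) \<partial>law q)" (is "_ = ?R")
proof -
  interpret law: prob_space "law q" by (rule prob_space_law[OF q])
  interpret P: prob_space P by (rule prob_space_P)
  interpret pair: pair_prob_space "law q" P ..
  have upd [measurable]: "(\<lambda>(t, x). x(q := t)) \<in> law q \<Otimes>\<^sub>M P \<rightarrow>\<^sub>M P"
    using q unfolding case_prod_beta
    by (intro measurable_fun_upd[where J = sources]) auto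
  have f [measurable]: "(\<lambda>(t, x). f (x(q := t))) \<in> borel_measurable (law q \<Otimes>\<^sub>M P)"
    using measurable_compose[OF upd assms(2)] by (simp add: case_prod_beta)
  have "P = distr (law q \<Otimes>\<^sub>M P) P (\<lambda>(t, x). x(q := t))"
    using distr_pair_PiM_eq_PiM[where M = law and I = sources and i' = q] prob_space_law q
    by (simp add: insert_absorb)
  then have "(\<integral>\<^sup>+x. f x \<partial>P) = (\<integral>\<^sup>+x. f x \<partial>distr (law q \<Otimes>\<^sub>M P) P (\<lambda>(t, x). x(q := t)))"
    by simp
  also have "\<dots> = (\<integral>\<^sup>+z. (case z of (t, x) \<Rightarrow> f (x(q := t))) \<partial>(law q \<Otimes>\<^sub>M P))"
    by (subst nn_integral_distr) (auto intro!: nn_integral_cong)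
  finally have *: "(\<integral>\<^sup>+x. f x \<partial>P) = (\<integral>\<^sup>+z. (case z of (t, x) \<Rightarrow> f (x(q := t))) \<partial>(law q \<Otimes>\<^sub>M P))" .
  show "(\<integral>\<^sup>+x. f x \<partial>P) = ?L" unfolding * by (subst pair.nn_integral_snd[symmetric]) auto
  show "(\<integral>\<^sup>+x. f x \<partial>P) = ?R" unfolding * by (subst P.nn_integral_fst[symmetric]) auto
qed

lemma AE_coord: "q \<in> sources \<Longrightarrow> AE t in law q. R t \<Longrightarrow> AE x in P. R (x q)"
  by (rule AE_PiM_component) (auto intro: prob_space_law)

text \<open>
  That coordinate \<open>q\<close> outlives \<open>\<tau>\<close> costs a factor \<open>exp (- \<rho> * \<tau>)\<close> and leaves the remaining
  waiting time distributed as before. Here \<open>\<tau>\<close> is random but does not read coordinate \<open>q\<close>, so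
  resampling \<open>q\<close> reduces the claim to a deterministic \<open>\<tau>\<close>.
\<close>

lemma memoryless_coordinate:
  assumes q: "q \<in> sources" "law q = expo \<rho>" "0 < \<rho>" and cmp: "cmp = (\<le>) \<or> cmp = (<)"
    and \<tau> [measurable]: "\<tau> \<in> borel_measurable P" and \<tau>0: "AE x in P. 0 \<le> \<tau> x"
    and \<tau>_q: "\<And>x t. \<tau> (x(q := t)) = \<tau> x"
    and f [measurable]: "f \<in> borel_measurable P"
  shows "(\<integral>\<^sup>+x. (if cmp (\<tau> x) (x q) then f (x(q := x q - \<tau> x)) else 0) \<partial>P)
    = (\<integral>\<^sup>+x. ennreal (exp (- \<rho> * \<tau> x)) * f x \<partial>P)"
proof -
  note measurable_coord[OF q(1), measurable]
  have [measurable]: "(\<lambda>x. x(q := x q - \<tau> x)) \<in> P \<rightarrow>\<^sub>M P"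
    by (rule measurable_upd[OF q(1)]) measurable
  have "Measurable.pred P (\<lambda>x. cmp (\<tau> x) (x q))"
    using cmp by (elim disjE) (auto simp: pred_def intro!: borel_measurable_le borel_measurable_less)
  then have [measurable]: "(\<lambda>x. if cmp (\<tau> x) (x q) then f (x(q := x q - \<tau> x)) else 0) \<in> borel_measurable P"
    by measurable
  have "(\<integral>\<^sup>+x. (if cmp (\<tau> x) (x q) then f (x(q := x q - \<tau> x)) else 0) \<partial>P)
    = (\<integral>\<^sup>+x. (\<integral>\<^sup>+t. (if cmp (\<tau> x) t then f (x(q := t - \<tau> x)) else 0) \<partial>expo \<rho>) \<partial>P)"
    by (subst resample(1)[OF q(1)]) (simp_all add: \<tau>_q q(2) cong: if_cong)
  also have "\<dots> = (\<integral>\<^sup>+x. (\<integral>\<^sup>+t. ennreal (exp (- \<rho> * \<tau> x)) * f (x(q := t)) \<partial>expo \<rho>) \<partial>P)"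
  proof (rule nn_integral_cong_AE)
    show "AE x in P. (\<integral>\<^sup>+t. (if cmp (\<tau> x) t then f (x(q := t - \<tau> x)) else 0) \<partial>expo \<rho>)
        = (\<integral>\<^sup>+t. ennreal (exp (- \<rho> * \<tau> x)) * f (x(q := t)) \<partial>expo \<rho>)"
      using \<tau>0 AE_space
    proof eventually_elim
      case (elim x)
      have "(\<lambda>t. x(q := t)) \<in> borel \<rightarrow>\<^sub>M P"
        by (rule measurable_upd[OF q(1)]) (use elim in auto)
      then have g: "(\<lambda>t. f (x(q := t))) \<in> borel_measurable borel" by measurable
      show ?case
        by (subst expo_memoryless[OF q(3) elim(1) cmp g], subst nn_integral_cmult) (use g in \<open>auto cong: measurable_cong_sets\<close>)
    qed
  qed
  also have "\<dots> = (\<integral>\<^sup>+x. ennreal (exp (- \<rho> * \<tau> x)) * f x \<partial>P)"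
    by (subst resample(1)[OF q(1), of "\<lambda>x. ennreal (exp (- \<rho> * \<tau> x)) * f x"]) (simp_all add: \<tau>_q q(2))
  finally show ?thesis .
qed

text \<open>
  The renumbering is injective and maps every source to one with the same law.
\<close>

lemma distr_drop_first: "distr P P (drop_first n) = P"
proof -
  have law: "law (shift_source n q) = law q" if "q \<in> sources" for q
    using that by (cases q) (auto simp: shift_source_def laws)
  have "distr P (PiM sources (\<lambda>q. law (shift_source n q))) (drop_first n) = PiM sources (\<lambda>q. law (shift_source n q))"
    unfolding drop_first_def
    by (rule distr_PiM_reindex) (auto intro: prob_space_law inj_shift_source shift_source_in_sources)
  then show ?thesis using PiM_cong[OF refl, of sources "\<lambda>q. law (shift_source n q)" law] law by simp
qed

lemma nn_integral_drop_first:
  "f \<in> borel_measurable P \<Longrightarrow> (\<integral>\<^sup>+x. f (drop_first n x) \<partial>P) = (\<integral>\<^sup>+x. f x \<partial>P)"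
  by (subst (2) distr_drop_first[symmetric, of n]) (simp add: nn_integral_distr)

lemma AE_wait_pos: "q \<in> sources \<Longrightarrow> law q = expo \<rho> \<Longrightarrow> AE x in P. 0 < x q"
  by (rule AE_coord) (simp_all only: AE_expo_pos)

text \<open>
  The Laplace transform at \<open>1\<close> of the sum of \<open>k\<close> waiting times is \<open>q ^ k\<close> with \<open>q < 1\<close>, so by Markov's
  inequality the probability that all partial sums stay below \<open>N\<close> is at most \<open>exp N * q ^ k\<close> for
  every \<open>k\<close>.
\<close>

lemma AE_other_times_diverge:
  assumes i: "1 \<le> i"
  shows "AE x in P. \<exists>k. real N < (\<Sum>m\<le>k. x (OtherWait i m))"
proof -
  interpret P: prob_space P by (rule prob_space_P)
  note [simp] = i i[simplified]
  define q where "q = lamo i / (1 + lamo i)"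
  have q: "0 < q" "q < 1" using lamo_pos[OF i] by (auto simp: q_def)
  have E: "(\<integral>\<^sup>+x. ennreal (exp (- (\<Sum>m<k. x (OtherWait i m)))) \<partial>P) = ennreal (q ^ k)" for k
  proof (induction k)
    case 0
    then show ?case by (simp add: P.emeasure_space_1)
  next
    case (Suc k)
    have "(\<integral>\<^sup>+x. ennreal (exp (- (\<Sum>m<Suc k. x (OtherWait i m)))) \<partial>P)
      = (\<integral>\<^sup>+t. (\<integral>\<^sup>+x. ennreal (exp (- t)) * ennreal (exp (- (\<Sum>m<k. x (OtherWait i m)))) \<partial>P) \<partial>expo (lamo i))"
      using law_OtherWait[OF i, of k]
      by (subst resample(2)[of "OtherWait i k"])
         (auto simp: ennreal_mult'[symmetric] exp_add[symmetric] intro!: nn_integral_cong)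
    also have "\<dots> = (\<integral>\<^sup>+t. ennreal (exp (- 1 * t)) * ennreal (q ^ k) \<partial>expo (lamo i))"
      by (subst nn_integral_cmult) (auto simp: Suc.IH)
    also have "\<dots> = (\<integral>\<^sup>+t. ennreal (exp (- 1 * t)) \<partial>expo (lamo i)) * ennreal (q ^ k)"
      by (rule nn_integral_multc) measurable
    also have "\<dots> = ennreal q * ennreal (q ^ k)"
      using lamo_pos[OF i] by (subst expo_laplace) (auto simp: q_def)
    also have "\<dots> = ennreal (q ^ Suc k)"
      using q by (simp add: ennreal_mult)
    finally show ?case .
  qed
  let ?B = "{x \<in> space P. \<forall>k. (\<Sum>m\<le>k. x (OtherWait i m)) \<le> real N}"
  have "emeasure P ?B \<le> ennreal (exp (real N) * q ^ Suc k)" for k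
  proof -
    have "emeasure P ?B = (\<integral>\<^sup>+x. indicator ?B x \<partial>P)"
      by (subst nn_integral_indicator) auto
    also have "\<dots> \<le> (\<integral>\<^sup>+x. ennreal (exp (real N)) * ennreal (exp (- (\<Sum>m<Suc k. x (OtherWait i m)))) \<partial>P)"
      by (intro nn_integral_mono)
         (auto simp: ennreal_mult'[symmetric] exp_add[symmetric] lessThan_Suc_atMost split: split_indicator)
    also have "\<dots> = ennreal (exp (real N) * q ^ Suc k)"
      by (subst nn_integral_cmult) (simp_all only: E, auto simp: ennreal_mult')
    finally show ?thesis .
  qed
  moreover have "(\<lambda>k. ennreal (exp (real N) * q ^ Suc k)) \<longlonglongrightarrow> ennreal (exp (real N) * 0)"
    using q by (intro tendsto_ennrealI tendsto_mult_left LIMSEQ_Suc LIMSEQ_power_zero) auto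
  ultimately have "emeasure P ?B \<le> 0"
    by (intro LIMSEQ_le_const[where X = "\<lambda>k. ennreal (exp (real N) * q ^ Suc k)"]) auto
  then have "?B \<in> null_sets P" by auto
  then show ?thesis
    by (rule AE_I') (auto simp: not_less)
qed

lemma AE_admissible: "AE x in P. admissible x"
proof -
  have "AE x in P. \<forall>i. 1 \<le> i \<longrightarrow> 0 < x (DefaultWait i)"
    using AE_wait_pos[OF _ law_DefaultWait] by (simp add: AE_all_countable)
  moreover have "AE x in P. \<forall>i k. 1 \<le> i \<longrightarrow> 0 < x (OtherWait i k)"
    using AE_wait_pos[OF _ law_OtherWait] by (simp add: AE_all_countable)
  moreover have "AE x in P. \<forall>i N. 1 \<le> i \<longrightarrow> (\<exists>k. real N < (\<Sum>m\<le>k. x (OtherWait i m)))"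
    using AE_other_times_diverge by (simp add: AE_all_countable)
  ultimately show ?thesis
    using AE_wait_pos[OF _ law_Horizon, simplified] by eventually_elim (auto simp: admissible_def)
qed

end

section \<open>Regeneration at the first event\<close>

context canonical_model
begin

lemma nn_integral_no_event:
  assumes n: "1 \<le> n"
  shows "(\<integral>\<^sup>+x. (if x Horizon < x (DefaultWait n) \<and> x Horizon < x (OtherWait n 0) then 1 else 0) \<partial>P)
    = ennreal (\<theta> / (lam n + lamo n + \<theta>))"
proof -
  note [simp] = n n[simplified]
  have H: "AE x in P. 0 \<le> x Horizon"
    using AE_wait_pos[OF _ law_Horizon, simplified] by (auto elim!: eventually_mono)
  have "(\<integral>\<^sup>+x. (if x Horizon < x (DefaultWait n) \<and> x Horizon < x (OtherWait n 0) then 1 else 0) \<partial>P)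
    = (\<integral>\<^sup>+x. (if x Horizon < x (DefaultWait n) then
          (\<lambda>y. if y Horizon < y (OtherWait n 0) then 1 else 0) (x(DefaultWait n := x (DefaultWait n) - x Horizon)) else 0) \<partial>P)"
    by (intro nn_integral_cong) auto
  also have "\<dots> = (\<integral>\<^sup>+x. ennreal (exp (- lam n * x Horizon)) * (if x Horizon < x (OtherWait n 0) then 1 else 0) \<partial>P)"
    by (rule memoryless_coordinate) (auto simp: laws lam_pos H)
  also have "\<dots> = (\<integral>\<^sup>+x. (if x Horizon < x (OtherWait n 0) then
        (\<lambda>y. ennreal (exp (- lam n * y Horizon))) (x(OtherWait n 0 := x (OtherWait n 0) - x Horizon)) else 0) \<partial>P)"
    by (intro nn_integral_cong) auto
  also have "\<dots> = (\<integral>\<^sup>+x. ennreal (exp (- lamo n * x Horizon)) * ennreal (exp (- lam n * x Horizon)) \<partial>P)"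
    by (rule memoryless_coordinate) (auto simp: laws lamo_pos H)
  also have "\<dots> = (\<integral>\<^sup>+x. ennreal (exp (- (lam n + lamo n) * x Horizon)) \<partial>P)"
    by (intro nn_integral_cong) (simp add: ennreal_mult'[symmetric] exp_add[symmetric] algebra_simps)
  also have "\<dots> = (\<integral>\<^sup>+t. (\<integral>\<^sup>+x. ennreal (exp (- (lam n + lamo n) * t)) \<partial>P) \<partial>expo \<theta>)"
    by (subst resample(2)[of Horizon]) (auto simp: laws)
  also have "\<dots> = (\<integral>\<^sup>+t. ennreal (exp (- (lam n + lamo n) * t)) \<partial>expo \<theta>)"
    by (simp add: prob_space.emeasure_space_1[OF prob_space_P])
  also have "\<dots> = ennreal (\<theta> / (lam n + lamo n + \<theta>))"
    using \<theta>_pos lam_pos[OF n] lamo_pos[OF n] by (intro expo_laplace) auto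
  finally show ?thesis .
qed

lemma measurable_kernel:
  assumes h: "(\<lambda>(t, l, x). h t l x) \<in> borel_measurable (borel \<Otimes>\<^sub>M borel \<Otimes>\<^sub>M P)"
    and [measurable]: "f \<in> borel_measurable N" "g \<in> borel_measurable N" "k \<in> N \<rightarrow>\<^sub>M P"
  shows "(\<lambda>w. h (f w) (g w) (k w)) \<in> borel_measurable N"
proof -
  have "(\<lambda>w. (f w, g w, k w)) \<in> N \<rightarrow>\<^sub>M borel \<Otimes>\<^sub>M borel \<Otimes>\<^sub>M P" by measurable
  from measurable_compose[OF this h] show ?thesis by simp
qed

text \<open>
  The horizon and the first non-default arrival both have to outlive the default, which by
  memorylessness costs \<open>exp (- (lamo n + \<theta>) * t)\<close>. The default time and its loss are then integrated
  out separately, as the restarted path \<open>x\<close> enters \<open>h\<close> only through other coordinates.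
\<close>

lemma nn_integral_default_first:
  assumes n: "1 \<le> n"
    and h: "(\<lambda>(t, l, x). h t l x) \<in> borel_measurable (borel \<Otimes>\<^sub>M borel \<Otimes>\<^sub>M P)"
    and h_upd: "\<And>t l x s. h t l (x(DefaultWait n := s)) = h t l x"
      "\<And>t l x s. h t l (x(DefaultLoss n := s)) = h t l x"
      "\<And>t l x s. h t l (x(OtherWait n 0 := s)) = h t l x"
  shows "(\<integral>\<^sup>+x. (if x (DefaultWait n) \<le> x (OtherWait n 0) \<and> x (DefaultWait n) \<le> x Horizon
        then h (x (DefaultWait n)) (x (DefaultLoss n)) (skip_default n x) else 0) \<partial>P)
    = (\<integral>\<^sup>+t. ennreal (exp (- (lamo n + \<theta>) * t)) * (\<integral>\<^sup>+l. (\<integral>\<^sup>+x. h t l x \<partial>P) \<partial>D) \<partial>expo (lam n))"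
proof -
  note [simp] = n n[simplified]
  note [measurable] = measurable_kernel[OF h]
  have T: "AE x in P. 0 \<le> x (DefaultWait n)"
    using AE_wait_pos[OF _ law_DefaultWait[OF n]] by (auto elim!: eventually_mono)
  let ?f = "\<lambda>y. if y (DefaultWait n) \<le> y (OtherWait n 0) then h (y (DefaultWait n)) (y (DefaultLoss n)) y else 0"
  let ?g = "\<lambda>y. ennreal (exp (- \<theta> * y (DefaultWait n))) * h (y (DefaultWait n)) (y (DefaultLoss n)) y"
  have "(\<integral>\<^sup>+x. (if x (DefaultWait n) \<le> x (OtherWait n 0) \<and> x (DefaultWait n) \<le> x Horizon
        then h (x (DefaultWait n)) (x (DefaultLoss n)) (skip_default n x) else 0) \<partial>P)
    = (\<integral>\<^sup>+x. (if x (DefaultWait n) \<le> x Horizon then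
          ?f (x(Horizon := x Horizon - x (DefaultWait n))) else 0) \<partial>P)"
    by (intro nn_integral_cong) (auto simp: skip_default_def)
  also have "\<dots> = (\<integral>\<^sup>+x. ennreal (exp (- \<theta> * x (DefaultWait n))) * ?f x \<partial>P)"
    by (rule memoryless_coordinate) (auto simp: laws \<theta>_pos T)
  also have "\<dots> = (\<integral>\<^sup>+x. (if x (DefaultWait n) \<le> x (OtherWait n 0) then
          ?g (x(OtherWait n 0 := x (OtherWait n 0) - x (DefaultWait n))) else 0) \<partial>P)"
    by (intro nn_integral_cong) (auto simp: h_upd)
  also have "\<dots> = (\<integral>\<^sup>+x. ennreal (exp (- lamo n * x (DefaultWait n))) * ?g x \<partial>P)"
    by (rule memoryless_coordinate) (auto simp: laws lamo_pos T)
  also have "\<dots> = (\<integral>\<^sup>+x. ennreal (exp (- (lamo n + \<theta>) * x (DefaultWait n)))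
      * h (x (DefaultWait n)) (x (DefaultLoss n)) x \<partial>P)"
    by (intro nn_integral_cong)
       (simp add: mult.assoc[symmetric] ennreal_mult'[symmetric] exp_add[symmetric] algebra_simps)
  also have "\<dots> = (\<integral>\<^sup>+t. (\<integral>\<^sup>+x. ennreal (exp (- (lamo n + \<theta>) * t)) * h t (x (DefaultLoss n)) x \<partial>P) \<partial>expo (lam n))"
    by (subst resample(2)[of "DefaultWait n"]) (auto simp: laws h_upd)
  also have "\<dots> = (\<integral>\<^sup>+t. ennreal (exp (- (lamo n + \<theta>) * t)) * (\<integral>\<^sup>+x. h t (x (DefaultLoss n)) x \<partial>P) \<partial>expo (lam n))"
    by (intro nn_integral_cong nn_integral_cmult) measurable
  also have "\<dots> = (\<integral>\<^sup>+t. ennreal (exp (- (lamo n + \<theta>) * t)) * (\<integral>\<^sup>+l. (\<integral>\<^sup>+x. h t l x \<partial>P) \<partial>D) \<partial>expo (lam n))"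
    by (subst resample(2)[of "DefaultLoss n"]) (auto simp: laws h_upd)
  finally show ?thesis .
qed

lemma drop_first_upd:
  "1 \<le> n \<Longrightarrow> drop_first n (x(OtherWait n 0 := s)) = drop_first n x"
  "1 \<le> n \<Longrightarrow> drop_first n (x(OtherLoss n 0 := s)) = drop_first n x"
  "1 \<le> n \<Longrightarrow> drop_first n (x(DefaultWait n := s)) = (drop_first n x)(DefaultWait n := s)"
  "drop_first n (x(Horizon := s)) = (drop_first n x)(Horizon := s)"
  by (auto simp: drop_first_def shift_source_def fun_eq_iff restrict_def split: source.splits)

text \<open>
  As for a default, but the restarted path stays in phase \<open>n\<close>: its remaining time to default is
  fresh by memorylessness, and the renumbered non-default events have the original law.
\<close>

lemma nn_integral_other_first:
  assumes n: "1 \<le> n"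
    and h: "(\<lambda>(t, l, x). h t l x) \<in> borel_measurable (borel \<Otimes>\<^sub>M borel \<Otimes>\<^sub>M P)"
  shows "(\<integral>\<^sup>+x. (if x (OtherWait n 0) < x (DefaultWait n) \<and> x (OtherWait n 0) \<le> x Horizon
        then h (x (OtherWait n 0)) (x (OtherLoss n 0)) (skip_other n x) else 0) \<partial>P)
    = (\<integral>\<^sup>+t. ennreal (exp (- (lam n + \<theta>) * t)) * (\<integral>\<^sup>+l. (\<integral>\<^sup>+x. h t l x \<partial>P) \<partial>Do) \<partial>expo (lamo n))"
proof -
  note [simp] = n n[simplified]
  note [measurable] = measurable_kernel[OF h]
  have T: "AE x in P. 0 \<le> x (OtherWait n 0)"
    using AE_wait_pos[OF _ law_OtherWait[OF n, of 0]] by (auto elim!: eventually_mono)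
  let ?f = "\<lambda>y. if y (OtherWait n 0) < y (DefaultWait n) then h (y (OtherWait n 0)) (y (OtherLoss n 0))
    (drop_first n (y(DefaultWait n := y (DefaultWait n) - y (OtherWait n 0)))) else 0"
  let ?g = "\<lambda>y. ennreal (exp (- \<theta> * y (OtherWait n 0))) * h (y (OtherWait n 0)) (y (OtherLoss n 0)) (drop_first n y)"
  have "(\<integral>\<^sup>+x. (if x (OtherWait n 0) < x (DefaultWait n) \<and> x (OtherWait n 0) \<le> x Horizon
        then h (x (OtherWait n 0)) (x (OtherLoss n 0)) (skip_other n x) else 0) \<partial>P)
    = (\<integral>\<^sup>+x. (if x (OtherWait n 0) \<le> x Horizon then
          ?f (x(Horizon := x Horizon - x (OtherWait n 0))) else 0) \<partial>P)"
    by (intro nn_integral_cong) (auto simp: skip_other_def drop_first_upd)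
  also have "\<dots> = (\<integral>\<^sup>+x. ennreal (exp (- \<theta> * x (OtherWait n 0))) * ?f x \<partial>P)"
    by (rule memoryless_coordinate) (auto simp: laws \<theta>_pos T)
  also have "\<dots> = (\<integral>\<^sup>+x. (if x (OtherWait n 0) < x (DefaultWait n) then
          ?g (x(DefaultWait n := x (DefaultWait n) - x (OtherWait n 0))) else 0) \<partial>P)"
    by (intro nn_integral_cong) auto
  also have "\<dots> = (\<integral>\<^sup>+x. ennreal (exp (- lam n * x (OtherWait n 0))) * ?g x \<partial>P)"
    by (rule memoryless_coordinate) (auto simp: laws lam_pos T)
  also have "\<dots> = (\<integral>\<^sup>+x. ennreal (exp (- (lam n + \<theta>) * x (OtherWait n 0)))
      * h (x (OtherWait n 0)) (x (OtherLoss n 0)) (drop_first n x) \<partial>P)"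
    by (intro nn_integral_cong)
       (simp add: mult.assoc[symmetric] ennreal_mult'[symmetric] exp_add[symmetric] algebra_simps)
  also have "\<dots> = (\<integral>\<^sup>+t. (\<integral>\<^sup>+x. ennreal (exp (- (lam n + \<theta>) * t)) * h t (x (OtherLoss n 0)) (drop_first n x) \<partial>P) \<partial>expo (lamo n))"
    by (subst resample(2)[of "OtherWait n 0"]) (auto simp: laws drop_first_upd)
  also have "\<dots> = (\<integral>\<^sup>+t. ennreal (exp (- (lam n + \<theta>) * t)) * (\<integral>\<^sup>+x. h t (x (OtherLoss n 0)) (drop_first n x) \<partial>P) \<partial>expo (lamo n))"
    by (intro nn_integral_cong nn_integral_cmult) measurable
  also have "\<dots> = (\<integral>\<^sup>+t. ennreal (exp (- (lam n + \<theta>) * t)) * (\<integral>\<^sup>+l. (\<integral>\<^sup>+x. h t l (drop_first n x) \<partial>P) \<partial>Do) \<partial>expo (lamo n))"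
    by (subst resample(2)[of "OtherLoss n 0"]) (auto simp: laws drop_first_upd)
  also have "\<dots> = (\<integral>\<^sup>+t. ennreal (exp (- (lam n + \<theta>) * t)) * (\<integral>\<^sup>+l. (\<integral>\<^sup>+x. h t l x \<partial>P) \<partial>Do) \<partial>expo (lamo n))"
    by (subst nn_integral_drop_first) auto
  finally show ?thesis .
qed

end

section \<open>The transform of the peak\<close>

text \<open>
  Numerator and denominator change sign together, at \<open>\<gamma> = \<kappa> / c\<close>. The sign is needed to pass from
  integrals with values in \<open>ennreal\<close>, where negative reals collapse to \<open>0\<close>, to real ones.
\<close>

lemma reflected_transform_nonneg:
  fixes c \<kappa> \<rho> \<gamma> y :: real
  assumes "0 \<le> \<rho>" "0 < c" "0 < \<kappa>" "0 \<le> y"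
  shows "0 \<le> \<rho> * (\<gamma> * (c / \<kappa>) * exp (- (\<kappa> / c) * y) - exp (- \<gamma> * y)) / (\<gamma> * c - \<kappa>)"
proof -
  let ?e = "exp (- (\<kappa> / c) * y)" and ?f = "exp (- \<gamma> * y)"
  consider "\<kappa> < \<gamma> * c" | "\<gamma> * c = \<kappa>" | "\<gamma> * c < \<kappa>" by linarith
  then show ?thesis
  proof cases
    case 1
    then have "1 \<le> \<gamma> * (c / \<kappa>)" "\<kappa> / c \<le> \<gamma>" using assms by (auto simp: field_simps)
    moreover have "?f \<le> ?e" using mult_right_mono[OF \<open>\<kappa> / c \<le> \<gamma>\<close> assms(4)] by simp
    moreover from calculation have "1 * ?e \<le> \<gamma> * (c / \<kappa>) * ?e"
      by (intro mult_right_mono) auto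
    ultimately have "?f \<le> \<gamma> * (c / \<kappa>) * ?e" by (simp only: mult_1_left)
    then show ?thesis using assms 1 by (intro divide_nonneg_pos mult_nonneg_nonneg) auto
  next
    case 3
    then have "\<gamma> * (c / \<kappa>) \<le> 1" "\<gamma> \<le> \<kappa> / c" using assms by (auto simp: field_simps)
    moreover have "?e \<le> ?f" using mult_right_mono[OF \<open>\<gamma> \<le> \<kappa> / c\<close> assms(4)] by simp
    moreover from calculation have "\<gamma> * (c / \<kappa>) * ?e \<le> 1 * ?e"
      by (intro mult_right_mono) auto
    ultimately have "\<gamma> * (c / \<kappa>) * ?e \<le> ?f" by (simp only: mult_1_left)
    then show ?thesis using assms 3 by (intro divide_nonpos_neg mult_nonneg_nonpos) auto
  qed simp
qed

lemma (in finite_measure) integrable_exp_minus: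
  assumes [measurable]: "f \<in> borel_measurable M" and "AE x in M. 0 \<le> f x" "0 \<le> \<gamma>"
  shows "integrable M (\<lambda>x. exp (- \<gamma> * f x :: real))"
  using assms(2,3) by (intro integrable_const_bound[where B = 1]) (auto elim!: eventually_mono)

context canonical_model
begin

definition peak_transform :: "nat \<Rightarrow> real \<Rightarrow> real" where
  "peak_transform n \<gamma> = (\<integral>x. exp (- \<gamma> * peak_version r n x) \<partial>P)"

lemma AE_peak_nonneg: "AE x in P. 0 \<le> peak_version r n x"
  using AE_admissible r_pos by (auto elim!: eventually_mono intro!: peak_version_nonneg simp: less_imp_le)

text \<open>
  The contribution of one kind of first event, of rate \<open>\<rho>\<close> and loss law \<open>\<nu>\<close>, while \<open>b\<close> collects the
  rates of the competing events. After exchanging the integrals, the innermost one is the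
  transform of the reflected level \<open>l + peak_version r m x\<close>, in which \<open>l\<close> and \<open>x\<close> separate.
\<close>

lemma event_transform:
  fixes \<nu> :: "real measure" and m :: nat
  assumes \<nu>: "prob_space \<nu>" "sets \<nu> = sets borel" "AE l in \<nu>. 0 \<le> l"
    and \<rho>: "0 < \<rho>" and b: "0 \<le> b" and c: "0 < c" and \<gamma>: "0 < \<gamma>" and \<kappa>: "\<kappa> = b + \<rho>" "\<gamma> * c \<noteq> \<kappa>"
  defines "R \<equiv> \<rho> * (\<gamma> * (c / \<kappa>) * (laplace \<nu> (\<lambda>l. l) (\<kappa> / c) * peak_transform m (\<kappa> / c))
      - laplace \<nu> (\<lambda>l. l) \<gamma> * peak_transform m \<gamma>) / (\<gamma> * c - \<kappa>)"
  shows "(\<integral>\<^sup>+t. ennreal (exp (- b * t)) * (\<integral>\<^sup>+l. (\<integral>\<^sup>+x.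
      ennreal (exp (- \<gamma> * max 0 (l - c * t + peak_version r m x))) \<partial>P) \<partial>\<nu>) \<partial>expo \<rho>) = ennreal R"
    and "0 \<le> R"
proof -
  interpret \<nu>: prob_space \<nu> by fact
  interpret P: prob_space P by (rule prob_space_P)
  interpret W: prob_space "expo \<rho>" by (rule prob_space_expo[OF \<rho>])
  interpret W\<nu>: pair_prob_space "expo \<rho>" \<nu> ..
  interpret WP: pair_prob_space "expo \<rho>" P ..
  note \<nu>(2) [simp, measurable_cong]
  have \<kappa>0: "0 < \<kappa>" using \<rho> b \<kappa> by simp
  define K where "K y = \<rho> * (\<gamma> * (c / \<kappa>) * exp (- (\<kappa> / c) * y) - exp (- \<gamma> * y)) / (\<gamma> * c - \<kappa>)" for y
  have K_nonneg: "0 \<le> K y" if "0 \<le> y" for y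
    using \<rho> c \<kappa>0 that unfolding K_def by (intro reflected_transform_nonneg) auto
  \<comment> \<open>\<open>K\<close> is a combination of two exponentials, hence a sum of products in \<open>l\<close> and \<open>w\<close>.\<close>
  define a1 where "a1 = \<rho> * (\<gamma> * (c / \<kappa>)) / (\<gamma> * c - \<kappa>)"
  define a2 where "a2 = \<rho> / (\<gamma> * c - \<kappa>)"
  have K_add: "K (l + w) = (a1 * exp (- (\<kappa> / c) * l)) * exp (- (\<kappa> / c) * w)
      - (a2 * exp (- \<gamma> * l)) * exp (- \<gamma> * w)" for l w
  proof -
    have "exp (- (\<kappa> / c) * (l + w)) = exp (- (\<kappa> / c) * l) * exp (- (\<kappa> / c) * w)"
      "exp (- \<gamma> * (l + w)) = exp (- \<gamma> * l) * exp (- \<gamma> * w)"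
      by (simp_all add: exp_add[symmetric] algebra_simps add_divide_distrib)
    then show ?thesis unfolding K_def a1_def a2_def
      by (simp only: right_diff_distrib diff_divide_distrib) (simp add: mult_ac)
  qed
  define KP where "KP l = a1 * peak_transform m (\<kappa> / c) * exp (- (\<kappa> / c) * l) - a2 * peak_transform m \<gamma> * exp (- \<gamma> * l)" for l
  have int_P: "integrable P (\<lambda>x. exp (- g * peak_version r m x))" if "0 \<le> g" for g
    by (rule P.integrable_exp_minus) (auto simp: AE_peak_nonneg that)
  have int_\<nu>: "integrable \<nu> (\<lambda>l. exp (- g * l))" if "0 \<le> g" for g
    by (rule \<nu>.integrable_exp_minus) (auto simp: \<nu> that)
  have x0: "0 \<le> \<kappa> / c" using \<kappa>0 c by simp
  have int1: "integrable P (\<lambda>x. K (l + peak_version r m x))" for l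
    unfolding K_add using int_P[OF x0] int_P[of \<gamma>] \<gamma> by (intro Bochner_Integration.integrable_diff integrable_mult_right) auto
  have val1: "(\<integral>x. K (l + peak_version r m x) \<partial>P) = KP l" for l
    unfolding K_add KP_def peak_transform_def using int_P[OF x0] int_P[of \<gamma>] \<gamma>
    by (subst Bochner_Integration.integral_diff) (simp_all add: mult_ac)
  have pos1: "AE x in P. 0 \<le> K (l + peak_version r m x)" if "0 \<le> l" for l
    using AE_peak_nonneg by eventually_elim (intro K_nonneg add_nonneg_nonneg that)
  have int2: "integrable \<nu> KP"
    unfolding KP_def using int_\<nu>[OF x0] int_\<nu>[of \<gamma>] \<gamma> by (intro Bochner_Integration.integrable_diff integrable_mult_right) auto
  have val2: "(\<integral>l. KP l \<partial>\<nu>) = R"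
  proof -
    have "(\<integral>l. KP l \<partial>\<nu>) = a1 * peak_transform m (\<kappa> / c) * laplace \<nu> (\<lambda>l. l) (\<kappa> / c) - a2 * peak_transform m \<gamma> * laplace \<nu> (\<lambda>l. l) \<gamma>"
      unfolding KP_def laplace_def using int_\<nu>[OF x0] int_\<nu>[of \<gamma>] \<gamma>
      by (subst Bochner_Integration.integral_diff) simp_all
    then show ?thesis unfolding R_def a1_def a2_def
      by (simp only: right_diff_distrib diff_divide_distrib) (simp add: mult_ac)
  qed
  have pos2: "AE l in \<nu>. 0 \<le> KP l"
    using \<nu>(3) by eventually_elim (unfold val1[symmetric], rule integral_nonneg_AE, rule pos1)
  show "0 \<le> R"
    unfolding val2[symmetric] by (rule integral_nonneg_AE[OF pos2])
  define F where "F t l x = ennreal (exp (- b * t)) * ennreal (exp (- \<gamma> * max 0 (l + peak_version r m x - c * t)))" for t l x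
  have "(\<integral>\<^sup>+t. ennreal (exp (- b * t)) * (\<integral>\<^sup>+l. (\<integral>\<^sup>+x.
      ennreal (exp (- \<gamma> * max 0 (l - c * t + peak_version r m x))) \<partial>P) \<partial>\<nu>) \<partial>expo \<rho>)
    = (\<integral>\<^sup>+t. (\<integral>\<^sup>+l. (\<integral>\<^sup>+x. F t l x \<partial>P) \<partial>\<nu>) \<partial>expo \<rho>)"
    unfolding F_def
    by (simp add: nn_integral_cmult add.commute add_diff_eq)
  also have "\<dots> = (\<integral>\<^sup>+l. (\<integral>\<^sup>+t. (\<integral>\<^sup>+x. F t l x \<partial>P) \<partial>expo \<rho>) \<partial>\<nu>)"
    unfolding F_def by (rule W\<nu>.Fubini'[symmetric]) measurable
  also have "\<dots> = (\<integral>\<^sup>+l. (\<integral>\<^sup>+x. (\<integral>\<^sup>+t. F t l x \<partial>expo \<rho>) \<partial>P) \<partial>\<nu>)"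
    unfolding F_def by (intro nn_integral_cong WP.Fubini'[symmetric]) measurable
  also have "\<dots> = (\<integral>\<^sup>+l. ennreal (KP l) \<partial>\<nu>)"
  proof (rule nn_integral_cong_AE)
    show "AE l in \<nu>. (\<integral>\<^sup>+x. (\<integral>\<^sup>+t. F t l x \<partial>expo \<rho>) \<partial>P) = ennreal (KP l)"
      using \<nu>(3)
    proof eventually_elim
      case (elim l)
      have "(\<integral>\<^sup>+x. (\<integral>\<^sup>+t. F t l x \<partial>expo \<rho>) \<partial>P) = (\<integral>\<^sup>+x. ennreal (K (l + peak_version r m x)) \<partial>P)"
      proof (rule nn_integral_cong_AE)
        show "AE x in P. (\<integral>\<^sup>+t. F t l x \<partial>expo \<rho>) = ennreal (K (l + peak_version r m x))"
          using AE_peak_nonneg[of m]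
        proof eventually_elim
          case (elim x)
          with \<open>0 \<le> l\<close> show ?case
            unfolding F_def K_def \<kappa>(1) using \<kappa> \<rho> b c by (intro expo_transform_reflected) auto
        qed
      qed
      also have "\<dots> = ennreal (KP l)"
        unfolding val1[symmetric] by (rule nn_integral_eq_integral[OF int1 pos1[OF elim]])
      finally show ?case .
    qed
  qed
  also have "\<dots> = ennreal R"
    unfolding val2[symmetric] by (rule nn_integral_eq_integral[OF int2 pos2])
  finally show "(\<integral>\<^sup>+t. ennreal (exp (- b * t)) * (\<integral>\<^sup>+l. (\<integral>\<^sup>+x.
      ennreal (exp (- \<gamma> * max 0 (l - c * t + peak_version r m x))) \<partial>P) \<partial>\<nu>) \<partial>expo \<rho>) = ennreal R" .
qed

lemma peak_transform_recursion:
  assumes n: "1 \<le> n" and \<gamma>: "0 < \<gamma>" and D_nonneg: "AE l in D. 0 \<le> l" and Do_nonneg: "AE l in Do. 0 \<le> l"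
    and \<kappa>: "\<kappa> = lam n + lamo n + \<theta>" "\<gamma> * r n \<noteq> \<kappa>"
  shows "peak_transform n \<gamma> = \<theta> / \<kappa>
    + lam n * (\<gamma> * (r n / \<kappa>) * (laplace D (\<lambda>l. l) (\<kappa> / r n) * peak_transform (n - 1) (\<kappa> / r n))
        - laplace D (\<lambda>l. l) \<gamma> * peak_transform (n - 1) \<gamma>) / (\<gamma> * r n - \<kappa>)
    + lamo n * (\<gamma> * (r n / \<kappa>) * (laplace Do (\<lambda>l. l) (\<kappa> / r n) * peak_transform n (\<kappa> / r n))
        - laplace Do (\<lambda>l. l) \<gamma> * peak_transform n \<gamma>) / (\<gamma> * r n - \<kappa>)"
    (is "_ = ?A + ?B + ?C")
proof -
  note [simp] = n n[simplified]
  interpret P: prob_space P by (rule prob_space_P)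
  have r: "\<forall>i\<ge>1. 0 \<le> r i" using r_pos by (simp add: less_imp_le)
  have pred: "n - 1 < n" using n by linarith
  note pos = \<theta>_pos lam_pos[OF n] lamo_pos[OF n] r_pos[OF n]
  have nonneg: "0 \<le> ?A" "0 \<le> ?B" "0 \<le> ?C"
  proof -
    show "0 \<le> ?A" using pos \<kappa> by simp
    show "0 \<le> ?B"
      using pos \<gamma> \<kappa> D_nonneg prob_space_D by (intro event_transform(2)[where b = "lamo n + \<theta>"]) auto
    show "0 \<le> ?C"
      using pos \<gamma> \<kappa> Do_nonneg prob_space_Do by (intro event_transform(2)[where b = "lam n + \<theta>"]) auto
  qed
  define h where "h m t l x = ennreal (exp (- \<gamma> * max 0 (l - r n * t + peak_version r m x)))" for m t l x
  have h [measurable]: "(\<lambda>(t, l, x). h m t l x) \<in> borel_measurable (borel \<Otimes>\<^sub>M borel \<Otimes>\<^sub>M P)" for m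
    unfolding h_def by measurable
  let ?a = "\<lambda>x. if x Horizon < x (DefaultWait n) \<and> x Horizon < x (OtherWait n 0) then 1 else 0 :: ennreal"
  let ?b = "\<lambda>x. if x (DefaultWait n) \<le> x (OtherWait n 0) \<and> x (DefaultWait n) \<le> x Horizon
        then h (n - 1) (x (DefaultWait n)) (x (DefaultLoss n)) (skip_default n x) else 0"
  let ?c = "\<lambda>x. if x (OtherWait n 0) < x (DefaultWait n) \<and> x (OtherWait n 0) \<le> x Horizon
        then h n (x (OtherWait n 0)) (x (OtherLoss n 0)) (skip_other n x) else 0"
  have [measurable]: "(\<lambda>x. peak_version r m (skip_default n x)) \<in> borel_measurable P"
      "(\<lambda>x. peak_version r m (skip_other n x)) \<in> borel_measurable P" for m
    by (rule measurable_compose[OF measurable_skip_default measurable_peak_version], simp,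
        rule measurable_compose[OF measurable_skip_other measurable_peak_version], simp)
  have [measurable]: "Measurable.pred P (\<lambda>x. x q \<le> x q')" "Measurable.pred P (\<lambda>x. x q < x q')"
    if "q \<in> sources" "q' \<in> sources" for q q'
    using that by (auto simp: pred_def intro!: borel_measurable_le borel_measurable_less measurable_coord)
  have meas: "?a \<in> borel_measurable P" "?b \<in> borel_measurable P" "?c \<in> borel_measurable P"
    unfolding h_def by measurable
  have "ennreal (peak_transform n \<gamma>) = (\<integral>\<^sup>+x. ennreal (exp (- \<gamma> * peak_version r n x)) \<partial>P)"
    unfolding peak_transform_def using \<gamma>
    by (intro nn_integral_eq_integral[symmetric] P.integrable_exp_minus) (auto simp: AE_peak_nonneg)
  also have "\<dots> = (\<integral>\<^sup>+x. ?a x + ?b x + ?c x \<partial>P)"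
  proof (rule nn_integral_cong_AE)
    show "AE x in P. ennreal (exp (- \<gamma> * peak_version r n x)) = ?a x + ?b x + ?c x"
      using AE_admissible
    proof eventually_elim
      case (elim x)
      consider "x Horizon < x (DefaultWait n)" "x Horizon < x (OtherWait n 0)"
        | "x (DefaultWait n) \<le> x (OtherWait n 0)" "x (DefaultWait n) \<le> x Horizon"
        | "x (OtherWait n 0) < x (DefaultWait n)" "x (OtherWait n 0) \<le> x Horizon"
        by linarith
      then show ?case
        unfolding peak_version_step[OF r elim n] by cases (simp_all add: h_def)
    qed
  qed
  also have "\<dots> = (\<integral>\<^sup>+x. ?a x \<partial>P) + (\<integral>\<^sup>+x. ?b x \<partial>P) + (\<integral>\<^sup>+x. ?c x \<partial>P)"
    using meas by (simp add: nn_integral_add)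
  also have "(\<integral>\<^sup>+x. ?a x \<partial>P) = ennreal ?A"
    using nn_integral_no_event[OF n] by (simp add: \<kappa>(1))
  also have "(\<integral>\<^sup>+x. ?b x \<partial>P) = ennreal ?B"
  proof (subst nn_integral_default_first[OF n h])
    show "(\<integral>\<^sup>+t. ennreal (exp (- (lamo n + \<theta>) * t)) * (\<integral>\<^sup>+l. (\<integral>\<^sup>+x. h (n - 1) t l x \<partial>P) \<partial>D) \<partial>expo (lam n)) = ennreal ?B"
      unfolding h_def using pos \<gamma> \<kappa> D_nonneg prob_space_D
      by (intro event_transform(1)) auto
  qed (simp_all only: h_def peak_version_upd[OF pred])
  also have "(\<integral>\<^sup>+x. ?c x \<partial>P) = ennreal ?C"
  proof (subst nn_integral_other_first[OF n h])
    show "(\<integral>\<^sup>+t. ennreal (exp (- (lam n + \<theta>) * t)) * (\<integral>\<^sup>+l. (\<integral>\<^sup>+x. h n t l x \<partial>P) \<partial>Do) \<partial>expo (lamo n)) = ennreal ?C"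
      unfolding h_def using pos \<gamma> \<kappa> Do_nonneg prob_space_Do
      by (intro event_transform(1)) auto
  qed
  also have "ennreal ?A + ennreal ?B + ennreal ?C = ennreal (?A + ?B + ?C)"
    using nonneg by (simp only: ennreal_plus add_nonneg_nonneg)
  finally show ?thesis
    using nonneg by (subst (asm) ennreal_inj) (auto simp: peak_transform_def)
qed

lemma peak_transform_0: "peak_transform 0 \<gamma> = 1"
  using prob_space.prob_space[OF prob_space_P]
  by (simp add: peak_transform_def peak_version_def peak_approx_0)

end

section \<open>From the peak to the ruin probability\<close>

lemma nn_integral_exp_interval:
  fixes \<gamma> w :: real
  assumes "0 < \<gamma>" "0 \<le> w"
  shows "(\<integral>\<^sup>+u. ennreal (exp (- \<gamma> * u)) * indicator {0<..w} u \<partial>lborel) = ennreal ((1 - exp (- \<gamma> * w)) / \<gamma>)"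
proof -
  have "(\<integral>\<^sup>+u. ennreal (exp (- \<gamma> * u)) * indicator {0<..w} u \<partial>lborel)
      = (\<integral>\<^sup>+u. ennreal (exp (- \<gamma> * u)) * indicator {0..w} u \<partial>lborel)"
  proof (rule nn_integral_cong_AE)
    have "AE u in lborel. u \<noteq> (0::real)" by (rule AE_lborel_singleton)
    then show "AE u in lborel. ennreal (exp (- \<gamma> * u)) * indicator {0<..w} u
        = ennreal (exp (- \<gamma> * u)) * indicator {0..w} u"
      by eventually_elim (auto split: split_indicator)
  qed
  also have "\<dots> = ennreal (- exp (- \<gamma> * w) / \<gamma> - (- exp (- \<gamma> * 0) / \<gamma>))"
    using assms by (intro nn_integral_FTC_Icc) (auto intro!: derivative_eq_intros)
  finally show ?thesis by (simp add: diff_divide_distrib)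
qed

text \<open>
  Fubini, with \<open>exp (- \<gamma> * u)\<close> integrated over \<open>0 < u \<le> W x\<close> first.
\<close>

lemma (in prob_space) tail_transform:
  assumes W [measurable]: "W \<in> borel_measurable M" and W0: "AE x in M. 0 \<le> W x" and \<gamma>: "0 < \<gamma>"
  shows "(LBINT u:{0<..}. exp (- \<gamma> * u) * measure M {x \<in> space M. u \<le> W x})
    = (1 - (\<integral>x. exp (- \<gamma> * W x) \<partial>M)) / \<gamma>"
proof -
  interpret pair_sigma_finite M lborel ..
  have tail: "ennreal (measure M {x \<in> space M. u \<le> W x}) = (\<integral>\<^sup>+x. indicator {..W x} u \<partial>M)" for u
  proof -
    have "(\<integral>\<^sup>+x. indicator {..W x} u \<partial>M) = (\<integral>\<^sup>+x. indicator {x \<in> space M. u \<le> W x} x \<partial>M)"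
      by (intro nn_integral_cong) (auto split: split_indicator)
    then show ?thesis by (simp add: emeasure_eq_measure)
  qed
  have "(\<lambda>u. measure M {x \<in> space M. u \<le> W x}) = (\<lambda>u. enn2real (\<integral>\<^sup>+x. indicator {..W x} u \<partial>M))"
    by (simp add: tail[symmetric])
  also have "\<dots> \<in> borel_measurable borel"
    unfolding indicator_def by simp
  finally have [measurable]: "(\<lambda>u. measure M {x \<in> space M. u \<le> W x}) \<in> borel_measurable borel" .
  have int: "integrable M (\<lambda>x. exp (- \<gamma> * W x))"
    using W0 \<gamma> by (intro integrable_exp_minus) auto
  have nn: "AE x in M. 0 \<le> (1 - exp (- \<gamma> * W x)) / \<gamma>"
    using W0 by eventually_elim (use \<gamma> in auto)
  have int': "integrable M (\<lambda>x. (1 - exp (- \<gamma> * W x)) / \<gamma>)"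
    using int by simp
  have val: "(\<integral>x. (1 - exp (- \<gamma> * W x)) / \<gamma> \<partial>M) = (1 - (\<integral>x. exp (- \<gamma> * W x) \<partial>M)) / \<gamma>"
    using int by (simp add: prob_space)
  have "(\<integral>\<^sup>+u. ennreal (indicator {0<..} u *\<^sub>R (exp (- \<gamma> * u) * measure M {x \<in> space M. u \<le> W x})) \<partial>lborel)
    = (\<integral>\<^sup>+u. (\<integral>\<^sup>+x. ennreal (exp (- \<gamma> * u)) * indicator {0<..W x} u \<partial>M) \<partial>lborel)"
  proof (rule nn_integral_cong)
    fix u :: real
    have "ennreal (indicator {0<..} u *\<^sub>R (exp (- \<gamma> * u) * measure M {x \<in> space M. u \<le> W x}))
      = (ennreal (exp (- \<gamma> * u)) * indicator {0<..} u) * (\<integral>\<^sup>+x. indicator {..W x} u \<partial>M)"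
      by (simp add: tail[symmetric] ennreal_mult' split: split_indicator)
    also have "\<dots> = (\<integral>\<^sup>+x. (ennreal (exp (- \<gamma> * u)) * indicator {0<..} u) * indicator {..W x} u \<partial>M)"
      unfolding indicator_def atMost_iff by (rule nn_integral_cmult[symmetric]) measurable
    also have "\<dots> = (\<integral>\<^sup>+x. ennreal (exp (- \<gamma> * u)) * indicator {0<..W x} u \<partial>M)"
      by (intro nn_integral_cong) (auto split: split_indicator)
    finally show "ennreal (indicator {0<..} u *\<^sub>R (exp (- \<gamma> * u) * measure M {x \<in> space M. u \<le> W x}))
      = (\<integral>\<^sup>+x. ennreal (exp (- \<gamma> * u)) * indicator {0<..W x} u \<partial>M)" .
  qed
  also have "\<dots> = (\<integral>\<^sup>+x. (\<integral>\<^sup>+u. ennreal (exp (- \<gamma> * u)) * indicator {0<..W x} u \<partial>lborel) \<partial>M)"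
    unfolding indicator_def greaterThanAtMost_iff by (rule Fubini') measurable
  also have "\<dots> = (\<integral>\<^sup>+x. ennreal ((1 - exp (- \<gamma> * W x)) / \<gamma>) \<partial>M)"
  proof (rule nn_integral_cong_AE)
    show "AE x in M. (\<integral>\<^sup>+u. ennreal (exp (- \<gamma> * u)) * indicator {0<..W x} u \<partial>lborel)
        = ennreal ((1 - exp (- \<gamma> * W x)) / \<gamma>)"
      using W0 by eventually_elim (rule nn_integral_exp_interval[OF \<gamma>])
  qed
  also have "\<dots> = ennreal ((1 - (\<integral>x. exp (- \<gamma> * W x) \<partial>M)) / \<gamma>)"
    unfolding val[symmetric] by (rule nn_integral_eq_integral[OF int' nn])
  finally have "(\<integral>\<^sup>+u. ennreal (indicator {0<..} u *\<^sub>R (exp (- \<gamma> * u) * measure M {x \<in> space M. u \<le> W x})) \<partial>lborel)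
    = ennreal ((1 - (\<integral>x. exp (- \<gamma> * W x) \<partial>M)) / \<gamma>)" .
  then show ?thesis
    unfolding set_lebesgue_integral_def
    using integral_nonneg_AE[OF nn] unfolding val
    by (intro integral_eq_nn_integral[THEN trans]) (auto simp: enn2real_ennreal)
qed

text \<open>
  A set that differs from a measurable one by a null set belongs to the completion.
\<close>

lemma ruin_prob_eq_tail:
  assumes V: "V \<in> borel_measurable M" and eq: "AE \<omega> in M. max_net_loss X r n \<omega> = V \<omega>"
  shows "ruin_prob M X r n u = measure M {\<omega> \<in> space M. u \<le> V \<omega>}"
proof -
  have V_set: "{\<omega> \<in> space M. u \<le> V \<omega>} \<in> sets M"
    using V by measurable
  have AE: "AE \<omega> in completion M. \<omega> \<in> {\<omega> \<in> space M. u \<le> V \<omega>} \<longleftrightarrow> \<omega> \<in> {\<omega> \<in> space M. max_net_loss X r n \<omega> \<ge> u}"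
    using AE_completion[OF eq] by eventually_elim auto
  have set: "{\<omega> \<in> space M. max_net_loss X r n \<omega> \<ge> u} \<in> sets (completion M)"
    by (rule completion.in_sets_AE[OF AE]) (use V_set in auto)
  have "measure (completion M) {\<omega> \<in> space M. max_net_loss X r n \<omega> \<ge> u}
      = measure (completion M) {\<omega> \<in> space M. u \<le> V \<omega>}"
    by (rule measure_eq_AE) (use AE set V_set in \<open>auto elim!: eventually_mono\<close>)
  then show ?thesis
    using V_set by (simp add: ruin_prob_def)
qed

text \<open>
  Independence says that the joint law of the sources is the product of their laws.
\<close>

lemma obligor_model_canonical:
  assumes "prob_space M" and "0 < \<theta>" and rates: "\<forall>i\<ge>1. 0 < lam i" "\<forall>i\<ge>1. 0 < lamo i" "\<forall>i\<ge>1. 0 < r i"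
    and L: "L \<in> borel_measurable M" "Lo \<in> borel_measurable M"
    and X: "obligor_model M lam lamo \<theta> L Lo X"
  shows "canonical_model lam lamo r \<theta> (distr M borel L) (distr M borel Lo) (\<lambda>q. distr M borel (X q))"
    and "(\<lambda>\<omega>. \<lambda>q\<in>sources. X q \<omega>) \<in> M \<rightarrow>\<^sub>M PiM sources (\<lambda>q. distr M borel (X q))"
    and "distr M (PiM sources (\<lambda>q. distr M borel (X q))) (\<lambda>\<omega>. \<lambda>q\<in>sources. X q \<omega>)
      = PiM sources (\<lambda>q. distr M borel (X q))"
proof -
  interpret prob_space M by fact
  have "distr M borel Y = distr M lborel Y" for Y :: "'a \<Rightarrow> real"
    by (rule distr_cong) auto
  then have expo: "distr M borel Y = expo \<rho>" if "distributed M lborel Y (exponential_density \<rho>)" for Y \<rho>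
    using distributed_distr_eq_density[OF that] by (simp add: expo_def)
  have indep: "indep_vars (\<lambda>_. borel) X sources"
    using X by (simp add: obligor_model_def)
  then have rv: "X q \<in> borel_measurable M" if "q \<in> sources" for q
    using that by (auto simp: indep_vars_def)
  show "canonical_model lam lamo r \<theta> (distr M borel L) (distr M borel Lo) (\<lambda>q. distr M borel (X q))"
  proof (rule canonical_model.intro)
    show "prob_space (distr M borel L)" "prob_space (distr M borel Lo)"
      using L by (auto intro: prob_space_distr)
    show "distr M borel (X Horizon) = expo \<theta>"
      using X by (intro expo) (simp add: obligor_model_def)
    fix i :: nat assume i: "1 \<le> i"
    show "0 < lam i" "0 < lamo i" "0 < r i" using i rates by auto
    show "distr M borel (X (DefaultWait i)) = expo (lam i)"
      using X i by (intro expo) (simp add: obligor_model_def)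
    show "distr M borel (X (DefaultLoss i)) = distr M borel L"
      using X i by (simp add: obligor_model_def)
    fix k
    show "distr M borel (X (OtherWait i k)) = expo (lamo i)"
      using X i by (intro expo) (simp add: obligor_model_def)
    show "distr M borel (X (OtherLoss i k)) = distr M borel Lo"
      using X i by (simp add: obligor_model_def)
  qed (simp_all add: assms(2))
  have "(\<lambda>\<omega>. \<lambda>q\<in>sources. X q \<omega>) \<in> M \<rightarrow>\<^sub>M PiM sources (\<lambda>q. borel :: real measure)"
    using rv by (rule measurable_restrict)
  moreover have sets_eq: "sets (PiM sources (\<lambda>q. distr M borel (X q))) = sets (PiM sources (\<lambda>q. borel :: real measure))"
    by (rule sets_PiM_cong) auto
  ultimately show "(\<lambda>\<omega>. \<lambda>q\<in>sources. X q \<omega>) \<in> M \<rightarrow>\<^sub>M PiM sources (\<lambda>q. distr M borel (X q))"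
    by (simp cong: measurable_cong_sets)
  have "sources \<noteq> {}" by (auto simp: sources_def)
  with indep rv have "distr M (PiM sources (\<lambda>q. borel)) (\<lambda>\<omega>. \<lambda>q\<in>sources. X q \<omega>) = PiM sources (\<lambda>q. distr M borel (X q))"
    by (subst (asm) indep_vars_iff_distr_eq_PiM') auto
  then show "distr M (PiM sources (\<lambda>q. distr M borel (X q))) (\<lambda>\<omega>. \<lambda>q\<in>sources. X q \<omega>)
      = PiM sources (\<lambda>q. distr M borel (X q))"
    using distr_cong[OF refl sets_eq, of M] by simp
qed

lemma ruin_transform_eq:
  assumes "prob_space M" and "0 < \<theta>" "\<forall>i\<ge>1. 0 < lam i" "\<forall>i\<ge>1. 0 < lamo i" "\<forall>i\<ge>1. 0 < r i"
    and "L \<in> borel_measurable M" "Lo \<in> borel_measurable M"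
    and "obligor_model M lam lamo \<theta> L Lo X" and \<gamma>: "0 < \<gamma>"
  shows "ruin_transform M X r n \<gamma>
    = (1 - canonical_model.peak_transform r (\<lambda>q. distr M borel (X q)) n \<gamma>) / \<gamma>"
proof -
  interpret prob_space M by fact
  note canonical = obligor_model_canonical[OF assms(1-8)]
  interpret canonical_model lam lamo r \<theta> "distr M borel L" "distr M borel Lo" "\<lambda>q. distr M borel (X q)"
    by (rule canonical(1))
  let ?R = "\<lambda>\<omega>. \<lambda>q\<in>sources. X q \<omega>"
  have R [measurable]: "?R \<in> M \<rightarrow>\<^sub>M P" by (rule canonical(2))
  have V: "(\<lambda>\<omega>. peak_version r n (?R \<omega>)) \<in> borel_measurable M"
    by (rule measurable_compose[OF R measurable_peak_version])
  have transfer: "AE \<omega> in M. Q (?R \<omega>)" if "AE x in P. Q x" for Q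
    using AE_distrD[OF R, of Q] that unfolding canonical(3) by simp
  have adm: "AE \<omega> in M. admissible (?R \<omega>)"
    using AE_admissible by (rule transfer)
  have r0: "\<forall>i\<ge>1. 0 \<le> r i" using r_pos by (simp add: less_imp_le)
  have "AE \<omega> in M. max_net_loss X r n \<omega> = peak_version r n (?R \<omega>)"
    using adm by eventually_elim (subst max_net_loss_restrict, simp only: peak_version_eq[OF r0])
  then have "ruin_transform M X r n \<gamma>
      = (LBINT u:{0<..}. exp (- \<gamma> * u) * measure M {\<omega> \<in> space M. u \<le> peak_version r n (?R \<omega>)})"
    unfolding ruin_transform_def by (simp add: ruin_prob_eq_tail[OF V])
  also have "\<dots> = (1 - (\<integral>\<omega>. exp (- \<gamma> * peak_version r n (?R \<omega>)) \<partial>M)) / \<gamma>"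
    using V transfer[OF AE_peak_nonneg] \<gamma> by (rule tail_transform)
  also have "(\<integral>\<omega>. exp (- \<gamma> * peak_version r n (?R \<omega>)) \<partial>M)
      = (\<integral>x. exp (- \<gamma> * peak_version r n x) \<partial>distr M P ?R)"
    by (rule integral_distr [OF R, symmetric]) measurable
  also have "\<dots> = peak_transform n \<gamma>"
    unfolding canonical(3) peak_transform_def by (rule refl)
  finally show ?thesis .
qed

lemma ruin_transform_0:
  fixes M :: "'a measure"
    and lam lamo r :: "nat \<Rightarrow> real" and \<theta> :: real
    and L Lo :: "'a \<Rightarrow> real"
    and X :: "source \<Rightarrow> 'a \<Rightarrow> real"
  assumes "prob_space M" and "0 < \<theta>" and rates: "\<forall>i\<ge>1. 0 < lam i" "\<forall>i\<ge>1. 0 < lamo i" "\<forall>i\<ge>1. 0 < r i"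
    and "L \<in> borel_measurable M" and "Lo \<in> borel_measurable M"
    and "obligor_model M lam lamo \<theta> L Lo X"
    and \<gamma>: "0 < \<gamma>"
  shows "ruin_transform M X r 0 \<gamma> = 0"
proof -
  interpret prob_space M by fact
  interpret canonical_model lam lamo r \<theta> "distr M borel L" "distr M borel Lo" "\<lambda>q. distr M borel (X q)"
    by (rule obligor_model_canonical(1)) fact+
  note \<psi> = ruin_transform_eq[OF assms(1-8)]
  from \<psi>[OF \<gamma>] show ?thesis by (simp add: peak_transform_0)
qed

text \<open>
  As \<open>1 / g - \<psi> g = peak_transform m g / g\<close>, each \<open>B\<close> is a loss transform times a peak transform,
  divided by \<open>g\<close>; the equation is then \<open>peak_transform_recursion\<close> rewritten in terms of \<open>\<psi>\<close>.
\<close>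

lemma ruin_transform_recursion:
  fixes M :: "'a measure"
    and lam lamo r :: "nat \<Rightarrow> real" and \<theta> :: real
    and L Lo :: "'a \<Rightarrow> real"
    and X :: "source \<Rightarrow> 'a \<Rightarrow> real"
  assumes "prob_space M" and "0 < \<theta>" and rates: "\<forall>i\<ge>1. 0 < lam i" "\<forall>i\<ge>1. 0 < lamo i" "\<forall>i\<ge>1. 0 < r i"
    and "L \<in> borel_measurable M" and "Lo \<in> borel_measurable M"
    and "obligor_model M lam lamo \<theta> L Lo X"
    and L: "AE \<omega> in M. 0 \<le> L \<omega>" and Lo: "AE \<omega> in M. 0 \<le> Lo \<omega>"
    and n: "1 \<le> n" and \<gamma>: "0 < \<gamma>" and \<kappa>_def: "\<kappa> = lam n + lamo n + \<theta>" and "\<gamma> \<noteq> \<kappa> / r n"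
  shows "ruin_transform M X r n \<gamma> = (lam n + lamo n) / \<kappa> * (1 / \<gamma>)
      + lam n / (\<kappa> - \<gamma> * r n) * (B M L (\<kappa> / r n) (ruin_transform M X r (n - 1) (\<kappa> / r n)) - B M L \<gamma> (ruin_transform M X r (n - 1) \<gamma>))
      + lamo n / (\<kappa> - \<gamma> * r n) * (B M Lo (\<kappa> / r n) (ruin_transform M X r n (\<kappa> / r n)) - B M Lo \<gamma> (ruin_transform M X r n \<gamma>))"
proof -
  interpret prob_space M by fact
  interpret canonical_model lam lamo r \<theta> "distr M borel L" "distr M borel Lo" "\<lambda>q. distr M borel (X q)"
    by (rule obligor_model_canonical(1)) fact+
  note \<psi> = ruin_transform_eq[OF assms(1-8)]
  have nonneg: "AE l in distr M borel L. 0 \<le> l" "AE l in distr M borel Lo. 0 \<le> l"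
    using L Lo assms(6,7) by (simp_all add: AE_distr_iff)
  have lap: "laplace (distr M borel Y) (\<lambda>l. l) g = laplace M Y g" if "Y \<in> borel_measurable M" for Y g
    unfolding laplace_def using that by (subst integral_distr) auto
  have B: "B M Y g (ruin_transform M X r m g) = laplace M Y g * peak_transform m g / g" if "0 < g" for Y g m
    using that by (simp add: B_def \<psi> diff_divide_distrib[symmetric])
  have pos: "0 < lam n" "0 < lamo n" "0 < r n" using n rates by auto
  have \<kappa>: "0 < \<kappa>" using pos \<theta>_pos by (simp add: \<kappa>_def)
  have x: "0 < \<kappa> / r n" using \<kappa> pos by simp
  have ne: "\<gamma> * r n \<noteq> \<kappa>" using \<open>\<gamma> \<noteq> \<kappa> / r n\<close> pos by (auto simp: field_simps)
  have split: "- (a * (\<gamma> * (r n / \<kappa>) * p - q) / (\<gamma> * r n - \<kappa>)) / \<gamma>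
      = a / (\<kappa> - \<gamma> * r n) * (p / (\<kappa> / r n) - q / \<gamma>)" for a p q
  proof -
    have "\<gamma> * r n - \<kappa> = - (\<kappa> - \<gamma> * r n)" by simp
    then have "- (a * z / (\<gamma> * r n - \<kappa>)) / \<gamma> = a / (\<kappa> - \<gamma> * r n) * (z / \<gamma>)" for z
      by (simp only: minus_divide_right [symmetric] minus_minus) simp
    moreover have "(\<gamma> * (r n / \<kappa>) * p - q) / \<gamma> = p / (\<kappa> / r n) - q / \<gamma>"
      using \<gamma> by (simp add: diff_divide_distrib)
    ultimately show ?thesis by (simp only:)
  qed
  have one: "1 - \<theta> / \<kappa> = (lam n + lamo n) / \<kappa>"
    using \<kappa> by (simp add: field_simps \<kappa>_def)
  define b where "b = lam n * (\<gamma> * (r n / \<kappa>) * (laplace (distr M borel L) (\<lambda>l. l) (\<kappa> / r n) * peak_transform (n - 1) (\<kappa> / r n))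
    - laplace (distr M borel L) (\<lambda>l. l) \<gamma> * peak_transform (n - 1) \<gamma>) / (\<gamma> * r n - \<kappa>)"
  define c where "c = lamo n * (\<gamma> * (r n / \<kappa>) * (laplace (distr M borel Lo) (\<lambda>l. l) (\<kappa> / r n) * peak_transform n (\<kappa> / r n))
    - laplace (distr M borel Lo) (\<lambda>l. l) \<gamma> * peak_transform n \<gamma>) / (\<gamma> * r n - \<kappa>)"
  have rec: "peak_transform n \<gamma> = \<theta> / \<kappa> + b + c"
    unfolding b_def c_def by (rule peak_transform_recursion[OF n \<gamma> nonneg \<kappa>_def ne])
  have b: "- b / \<gamma> = lam n / (\<kappa> - \<gamma> * r n) *
      (B M L (\<kappa> / r n) (ruin_transform M X r (n - 1) (\<kappa> / r n)) - B M L \<gamma> (ruin_transform M X r (n - 1) \<gamma>))"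
    unfolding b_def B[OF \<gamma>] B[OF x] lap[OF assms(6)] by (rule split)
  have c: "- c / \<gamma> = lamo n / (\<kappa> - \<gamma> * r n) *
      (B M Lo (\<kappa> / r n) (ruin_transform M X r n (\<kappa> / r n)) - B M Lo \<gamma> (ruin_transform M X r n \<gamma>))"
    unfolding c_def B[OF \<gamma>] B[OF x] lap[OF assms(7)] by (rule split)
  have "ruin_transform M X r n \<gamma> = (1 - (\<theta> / \<kappa> + b + c)) / \<gamma>"
    using \<psi>[OF \<gamma>, of n] by (simp only: rec)
  also have "\<dots> = (lam n + lamo n) / \<kappa> * (1 / \<gamma>) + - b / \<gamma> + - c / \<gamma>"
    unfolding one[symmetric] by (simp add: add_divide_distrib diff_divide_distrib)
  finally show ?thesis
    by (rule trans) (intro arg_cong2[where f = "(+)"] refl b c)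
qed

theorem mainTheorem6:
  fixes M :: "'a measure"
    and lam lamo r :: "nat \<Rightarrow> real" and \<theta> :: real
    and L Lo :: "'a \<Rightarrow> real"
    and X :: "source \<Rightarrow> 'a \<Rightarrow> real"
  assumes "\<theta> > 0"
    and "\<And>i. i \<ge> 1 \<Longrightarrow> lam i > 0"
    and "\<And>i. i \<ge> 1 \<Longrightarrow> lamo i > 0"
    and "\<And>i. i \<ge> 1 \<Longrightarrow> r i > 0"
    and "prob_space M"
    and "L \<in> borel_measurable M" and "AE \<omega> in M. L \<omega> \<ge> 0"
    and "Lo \<in> borel_measurable M" and "AE \<omega> in M. Lo \<omega> \<ge> 0"
    and "obligor_model M lam lamo \<theta> L Lo X"
  shows "(\<forall>\<gamma>>0. ruin_transform M X r 0 \<gamma> = 0) \<and>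
    (\<forall>n\<ge>1. \<forall>\<gamma>>0.
      let \<psi> = ruin_transform M X r; lbar = lam n + lamo n; x = (lbar + \<theta>) / r n in
      \<gamma> \<noteq> x \<longrightarrow>
      \<psi> n \<gamma> = lbar / (lbar + \<theta>) * (1 / \<gamma>)
        + lam n / (lbar + \<theta> - \<gamma> * r n) * (B M L x (\<psi> (n - 1) x) - B M L \<gamma> (\<psi> (n - 1) \<gamma>))
        + lamo n / (lbar + \<theta> - \<gamma> * r n) * (B M Lo x (\<psi> n x) - B M Lo \<gamma> (\<psi> n \<gamma>)))"
proof -
  have rates: "\<forall>i\<ge>1. 0 < lam i" "\<forall>i\<ge>1. 0 < lamo i" "\<forall>i\<ge>1. 0 < r i"
    using assms(2-4) by auto
  note model = assms(5,1) rates assms(6,8,10)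
  show ?thesis
    unfolding Let_def
    by (intro conjI allI impI)
       (erule ruin_transform_0[OF model], rule ruin_transform_recursion[OF model assms(7,9) _ _ refl])
qed

end
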